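(* Let $A$ be a commutative Noetherian ring with $1$, let $M$ be a free $A$-module of rank $n$ with basis $e_1,\dots,e_n$, let $\omega_1,\dots,\omega_r\in M$ ($r\ge 1$), and let $I\subseteq A$ be the ideal generated by the coefficients of $\omega_1\wedge\cdots\wedge\omega_r$ with respect to the basis $\{e_{i_1}\wedge\cdots\wedge e_{i_r}\mid 1\le i_1<\cdots<i_r\le n\}$ of $\wedge^rM$. Let $\omega\in\wedge^kM$ satisfy $\omega_i\wedge\omega=0$ for $i=1,\dots,r$. (a) There exists $m\ge 0$ with the property that if $g\in I^m$, then $$g\omega=\omega_1\wedge\cdots\wedge\omega_r\wedge\alpha$$ for some $\alpha\in\wedge^{k-r}M$. (b) If $\mathrm{depth}(I)>0$ and $k<\mathrm{depth}(I)+r-1$, then there exists $\alpha\in\wedge^{k-r}M$ such that $$\omega=\omega_1\wedge\cdots\wedge\omega_r\wedge\alpha.$$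
   Context: $\wedge^kM$ is the $k$-th exterior power of $M$ over $A$, with $\wedge^jM=0$ for $j<0$. $\mathrm{depth}(I)$ is the depth (grade) of the ideal $I$ on $A$, i.e. the maximal length of an $A$-regular sequence contained in $I$ (with $\mathrm{depth}(A)=\infty$ for the unit ideal). *)

theory Defs
  imports
    "HOL-Algebra.QuotRing"
    "HOL-Algebra.Ideal_Product"
    "HOL-Algebra.Ring_Divisibility"
    "HOL-Algebra.Algebraic_Closure_Type"
    "HOL-Library.Poly_Mapping"
    "HOL-Library.Extended_Nat"
    "HOL-Library.Extended_Real"
begin

text \<open>
  Words form the free monoid under concatenation. Hence \<open>'b list \<Rightarrow>\<^sub>0 'a\<close> with the convolution
  product of \<^theory>\<open>HOL-Library.Poly_Mapping\<close> is the free associative \<open>'a\<close>-algebra on the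
  underlying set of \<open>'b\<close>.
\<close>

instantiation list :: (type) monoid_add
begin

definition zero_list :: "'a list" where "zero_list = []"

definition plus_list :: "'a list \<Rightarrow> 'a list \<Rightarrow> 'a list" where "plus_list = append"

instance
  by standard (simp_all add: zero_list_def plus_list_def)

end

subsection \<open>The exterior algebra of a module\<close>

text \<open>
  The first two families of relations turn the free algebra on the set \<open>M\<close> into the tensor algebra
  of the module \<open>M\<close>; the third one, \<open>v \<otimes> v = 0\<close>, turns that into the exterior algebra.
  For noncommutative rings, \<^const>\<open>genideal\<close> is the generated two-sided ideal.
\<close>

definition ext_relations ::
    "('a::comm_ring_1 \<Rightarrow> 'b::ab_group_add \<Rightarrow> 'b) \<Rightarrow> ('b list \<Rightarrow>\<^sub>0 'a) set" where
  "ext_relations scale =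
     {Poly_Mapping.single [u + v] 1 - Poly_Mapping.single [u] 1 - Poly_Mapping.single [v] 1 | u v. True}
   \<union> {Poly_Mapping.single [scale a v] 1 - Poly_Mapping.single [v] a | a v. True}
   \<union> {Poly_Mapping.single [v, v] 1 | v. True}"

definition ext_ideal ::
    "('a::comm_ring_1 \<Rightarrow> 'b::ab_group_add \<Rightarrow> 'b) \<Rightarrow> ('b list \<Rightarrow>\<^sub>0 'a) set" where
  "ext_ideal scale = Idl\<^bsub>ring_of_type_algebra\<^esub> (ext_relations scale)"

text \<open>The multiplication of this quotient ring is the wedge product.\<close>

definition ext_algebra ::
    "('a::comm_ring_1 \<Rightarrow> 'b::ab_group_add \<Rightarrow> 'b) \<Rightarrow> ('b list \<Rightarrow>\<^sub>0 'a) set ring" where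
  "ext_algebra scale = ring_of_type_algebra Quot ext_ideal scale"

definition ext_class ::
    "('a::comm_ring_1 \<Rightarrow> 'b::ab_group_add \<Rightarrow> 'b) \<Rightarrow> ('b list \<Rightarrow>\<^sub>0 'a) \<Rightarrow> ('b list \<Rightarrow>\<^sub>0 'a) set" where
  "ext_class scale x = ext_ideal scale +>\<^bsub>ring_of_type_algebra\<^esub> x"

text \<open>For negative \<open>k\<close> only \<open>x = 0\<close> qualifies, so the \<open>k\<close>-th exterior power is then zero.\<close>

definition ext_power ::
    "('a::comm_ring_1 \<Rightarrow> 'b::ab_group_add \<Rightarrow> 'b) \<Rightarrow> int \<Rightarrow> ('b list \<Rightarrow>\<^sub>0 'a) set set" where
  "ext_power scale k =
     ext_class scale ` {x. \<forall>xs \<in> Poly_Mapping.keys x. int (length xs) = k}"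

definition ext_vec ::
    "('a::comm_ring_1 \<Rightarrow> 'b::ab_group_add \<Rightarrow> 'b) \<Rightarrow> 'b \<Rightarrow> ('b list \<Rightarrow>\<^sub>0 'a) set" where
  "ext_vec scale v = ext_class scale (Poly_Mapping.single [v] 1)"

definition ext_scale ::
    "('a::comm_ring_1 \<Rightarrow> 'b::ab_group_add \<Rightarrow> 'b) \<Rightarrow> 'a \<Rightarrow>
      ('b list \<Rightarrow>\<^sub>0 'a) set \<Rightarrow> ('b list \<Rightarrow>\<^sub>0 'a) set" where
  "ext_scale scale a y = ext_class scale (Poly_Mapping.single [] a) \<otimes>\<^bsub>ext_algebra scale\<^esub> y"

definition wedge_list ::
    "('a::comm_ring_1 \<Rightarrow> 'b::ab_group_add \<Rightarrow> 'b) \<Rightarrow> 'b list \<Rightarrow> ('b list \<Rightarrow>\<^sub>0 'a) set" where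
  "wedge_list scale vs =
     foldr (\<lambda>v y. ext_vec scale v \<otimes>\<^bsub>ext_algebra scale\<^esub> y) vs \<one>\<^bsub>ext_algebra scale\<^esub>"

subsection \<open>Free modules and coefficients\<close>

text \<open>
  \<open>Modules.module\<close> is the type-based locale of \<^theory>\<open>HOL.Modules\<close>, as opposed to the
  record-based one of HOL-Algebra.
\<close>

definition free_basis ::
    "('a::comm_ring_1 \<Rightarrow> 'b::ab_group_add \<Rightarrow> 'b) \<Rightarrow> nat \<Rightarrow> (nat \<Rightarrow> 'b) \<Rightarrow> bool" where
  "free_basis scale n e \<longleftrightarrow>
     inj_on e {1..n} \<and>
     \<not> Modules.module.dependent scale (e ` {1..n}) \<and>
     Modules.module.span scale (e ` {1..n}) = UNIV"

text \<open>
  A subset \<open>S = {i\<^sub>1 < \<dots> < i\<^sub>r}\<close> of \<open>{1..n}\<close> indexes the basis element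
  \<open>e i\<^sub>1 \<and> \<dots> \<and> e i\<^sub>r\<close> of the \<open>r\<close>-th exterior power.
\<close>

definition has_coeffs ::
    "('a::comm_ring_1 \<Rightarrow> 'b::ab_group_add \<Rightarrow> 'b) \<Rightarrow> nat \<Rightarrow> (nat \<Rightarrow> 'b) \<Rightarrow> nat \<Rightarrow>
      ('b list \<Rightarrow>\<^sub>0 'a) set \<Rightarrow> (nat set \<Rightarrow> 'a) \<Rightarrow> bool" where
  "has_coeffs scale n e r y c \<longleftrightarrow>
     y = (\<Oplus>\<^bsub>ext_algebra scale\<^esub> S \<in> {S. S \<subseteq> {1..n} \<and> card S = r}.
            ext_scale scale (c S) (wedge_list scale (map e (sorted_list_of_set S))))"

subsection \<open>Depth\<close>

definition regular_sequence :: "'a::comm_ring_1 list \<Rightarrow> bool" where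
  "regular_sequence xs \<longleftrightarrow>
     (\<forall>i < length xs. \<forall>y. xs ! i * y \<in> Idl\<^bsub>ring_of_type_algebra\<^esub> (set (take i xs)) \<longrightarrow>
        y \<in> Idl\<^bsub>ring_of_type_algebra\<^esub> (set (take i xs))) \<and>
     Idl\<^bsub>ring_of_type_algebra\<^esub> (set xs) \<noteq> UNIV"

definition depth :: "'a::comm_ring_1 set \<Rightarrow> enat" where
  "depth I = (if I = UNIV then \<infinity>
     else Sup {enat (length xs) | xs. regular_sequence xs \<and> set xs \<subseteq> I})"

end

(* The exterior algebra is the free algebra on words modulo an ideal E, and E is stable under the
   contraction (antiderivation) of the free algebra attached to a linear form. Contracting r times
   along a dual basis reads off the coefficients c_S of u = w_1 ... w_r, and the product rule gives two
   identities modulo E. If w_i y = 0 for all i, then c_S y = u z up to sign, where z is the r-fold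
   contraction of y; hence (a) holds already with m = 1. And modulo right multiples of the w_i, the
   r-fold contraction of u y is c_S y; hence u y = 0 implies that I y is contained in the right ideal
   (w_1, ..., w_r).

   For (b), take a regular sequence x, x_2, ..., x_d in I. By (a), x y = u a, so u a vanishes modulo x.
   A de Rham-type division lemma, proved by induction on the length of the sequence over all base ideals
   K simultaneously, says that if u a vanishes modulo K and deg a is smaller than the length of a
   K-regular sequence in I, then a lies in (w_1, ..., w_r) modulo K. For K = (x) this gives
   u a = x u b, and x can be cancelled because the exterior algebra is free. *)
theory Submission
  imports Defs
begin

subsection \<open>Ideals of type-class rings and the free algebra\<close>

text \<open>Everything is computed with representatives in the free algebra, where contraction is
  defined word by word; equality in the exterior algebra is membership of a difference in
  \<open>ext_ideal scale\<close>. Working modulo a base ideal K likewise means subtracting an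
  element with coefficients in K. So A stays fixed and no type for A/K is needed, although K changes
  during the induction. The obstacle in the division lemma is that contraction only gives x y = t
  modulo K with t in the right ideal (w_1, ..., w_r), and x must still be cancelled. So t has to
  become x times another element of that right ideal. It vanishes modulo K + (x), and its cofactors
  have smaller degree than y and are killed by u modulo K + (x), so the shorter sequence takes care
  of them. This is why degree is measured against length. The constant in (b) comes from this count:
  a has degree k - r, one element of the sequence is spent on x y = u a, and the other d - 1
  elements require k - r < d - 1.\<close>

lemma ring_of_type_algebra_simps [simp]:
  "carrier (ring_of_type_algebra :: 'a::ring_1 ring) = UNIV"
  "x \<otimes>\<^bsub>ring_of_type_algebra\<^esub> y = (x * y :: 'a)"
  "x \<oplus>\<^bsub>ring_of_type_algebra\<^esub> y = (x + y :: 'a)"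
  "\<one>\<^bsub>ring_of_type_algebra\<^esub> = (1 :: 'a)"
  "\<zero>\<^bsub>ring_of_type_algebra\<^esub> = (0 :: 'a)"
  by (simp_all add: ring_of_type_algebra_def)

lemma ring_ring_of_type_algebra: "ring (ring_of_type_algebra :: 'a::ring_1 ring)"
proof -
  have "\<exists>y. y + x = 0" for x :: 'a
    using add.left_inverse by blast
  moreover have "\<exists>y. x + y = 0" for x :: 'a
    using add.right_inverse by blast
  ultimately show ?thesis
    by unfold_locales (auto simp: algebra_simps Units_def)
qed

lemma ideal_ring_of_type_algebra_iff:
  fixes K :: "'a::ring_1 set"
  shows "ideal K ring_of_type_algebra \<longleftrightarrow>
    0 \<in> K \<and> (\<forall>x\<in>K. \<forall>y\<in>K. x + y \<in> K) \<and> (\<forall>x\<in>K. \<forall>a. a * x \<in> K \<and> x * a \<in> K)"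
    (is "_ \<longleftrightarrow> ?R")
proof
  assume "ideal K (ring_of_type_algebra :: 'a ring)"
  then interpret ideal K "ring_of_type_algebra :: 'a ring" .
  show ?R
    using additive_subgroup.zero_closed[OF additive_subgroup_axioms]
      additive_subgroup.a_closed[OF additive_subgroup_axioms] I_l_closed I_r_closed by auto
next
  assume R: ?R
  interpret ring "ring_of_type_algebra :: 'a ring"
    by (rule ring_ring_of_type_algebra)
  \<comment> \<open>\<open>idealI\<close> speaks of inverses in the additive monoid record; once
    these are unary minus, closure follows from multiplication by -1.\<close>
  have m: "inv\<^bsub>add_monoid (ring_of_type_algebra :: 'a ring)\<^esub> x = - x" for x :: 'a
    using minus_equality[of "- x" x] by (simp add: a_inv_def)
  show "ideal K (ring_of_type_algebra :: 'a ring)"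
  proof (rule idealI)
    show "subgroup K (add_monoid (ring_of_type_algebra :: 'a ring))"
    proof (unfold_locales, goal_cases)
      case (4 x)
      then have "- 1 * x \<in> K" using R by blast
      then have "- x \<in> K" by simp
      then show ?case by (simp only: m)
    qed (use R in auto)
  qed (use R in \<open>auto intro: ring_ring_of_type_algebra\<close>)
qed

lemma
  fixes K :: "'a::ring_1 set"
  assumes "ideal K ring_of_type_algebra"
  shows type_ideal_0: "0 \<in> K"
    and type_ideal_add: "x \<in> K \<Longrightarrow> y \<in> K \<Longrightarrow> x + y \<in> K"
    and type_ideal_lmult: "x \<in> K \<Longrightarrow> a * x \<in> K"
    and type_ideal_rmult: "x \<in> K \<Longrightarrow> x * a \<in> K"
    and type_ideal_uminus: "x \<in> K \<Longrightarrow> - x \<in> K"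
    and type_ideal_diff: "x \<in> K \<Longrightarrow> y \<in> K \<Longrightarrow> x - y \<in> K"
proof -
  note R = assms[unfolded ideal_ring_of_type_algebra_iff]
  show "0 \<in> K" "x \<in> K \<Longrightarrow> y \<in> K \<Longrightarrow> x + y \<in> K" "x \<in> K \<Longrightarrow> a * x \<in> K" "x \<in> K \<Longrightarrow> x * a \<in> K"
    using R by auto
  have m: "- x \<in> K" if "x \<in> K" for x
    using R that by (metis mult_minus1)
  show "x \<in> K \<Longrightarrow> - x \<in> K" by (rule m)
  show "x \<in> K \<Longrightarrow> y \<in> K \<Longrightarrow> x - y \<in> K"
    using R m by (metis add_uminus_conv_diff)
qed

lemma ideal_0: "ideal {0 :: 'a::comm_ring_1} ring_of_type_algebra"
  by (simp add: ideal_ring_of_type_algebra_iff)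

lemma type_ideal_sum:
  assumes "ideal K (ring_of_type_algebra :: 'a::ring_1 ring)" "\<And>i. i \<in> A \<Longrightarrow> f i \<in> K"
  shows "sum f A \<in> K"
  using assms(2)
  by (induction A rule: infinite_finite_induct)
    (auto simp: type_ideal_0[OF assms(1)] intro: type_ideal_add[OF assms(1)])

lemma
  fixes S :: "'a::ring_1 set"
  shows type_Idl_ideal: "ideal (Idl\<^bsub>ring_of_type_algebra\<^esub> S) ring_of_type_algebra"
    and type_Idl_superset: "S \<subseteq> Idl\<^bsub>ring_of_type_algebra\<^esub> S"
    and type_Idl_minimal: "ideal K ring_of_type_algebra \<Longrightarrow> S \<subseteq> K \<Longrightarrow> Idl\<^bsub>ring_of_type_algebra\<^esub> S \<subseteq> K"
proof -
  interpret ring "ring_of_type_algebra :: 'a ring"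
    by (rule ring_ring_of_type_algebra)
  show "ideal (Idl\<^bsub>ring_of_type_algebra\<^esub> S) ring_of_type_algebra"
    by (rule genideal_ideal) simp
  show "S \<subseteq> Idl\<^bsub>ring_of_type_algebra\<^esub> S"
    by (rule genideal_self) simp
  show "ideal K ring_of_type_algebra \<Longrightarrow> S \<subseteq> K \<Longrightarrow> Idl\<^bsub>ring_of_type_algebra\<^esub> S \<subseteq> K"
    by (rule genideal_minimal)
qed

section \<open>The free algebra: monomials, central scalars, constant terms\<close>

type_synonym ('a, 'b) free_alg = "'b list \<Rightarrow>\<^sub>0 'a"

abbreviation sc :: "'a::comm_ring_1 \<Rightarrow> ('a, 'b) free_alg" where
  "sc a \<equiv> Poly_Mapping.single [] a"

abbreviation wd :: "'b list \<Rightarrow> ('a::comm_ring_1, 'b) free_alg" where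
  "wd w \<equiv> Poly_Mapping.single w 1"

lemma single_mult_single [simp]:
  "Poly_Mapping.single v a * Poly_Mapping.single w b = Poly_Mapping.single (v @ w) (a * b :: 'a::comm_ring_1)"
  by (simp add: mult_single plus_list_def)

lemma sc_1: "sc 1 = 1"
  by (simp add: zero_list_def flip: single_one)

text \<open>The monomial case keeps the words and coefficients of x itself, so conditions on the
  support or on the coefficients survive; the graded induction rules below depend on this.\<close>

lemma free_alg_induct [consumes 0, case_names zero single add]:
  fixes x :: "('a::comm_ring_1, 'b) free_alg"
  assumes "P 0" and single: "\<And>w. w \<in> Poly_Mapping.keys x \<Longrightarrow> P (Poly_Mapping.single w (Poly_Mapping.lookup x w))"
    and add: "\<And>x y. P x \<Longrightarrow> P y \<Longrightarrow> P (x + y)"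
  shows "P x"
proof -
  have "P (\<Sum>w\<in>A. Poly_Mapping.single w (Poly_Mapping.lookup x w))" if "A \<subseteq> Poly_Mapping.keys x" for A
    using that by (induction A rule: infinite_finite_induct) (auto intro: assms)
  moreover have "(\<Sum>w\<in>Poly_Mapping.keys x. Poly_Mapping.single w (Poly_Mapping.lookup x w)) = x"
    by (rule poly_mapping_eqI)
      (auto simp: lookup_sum lookup_single when_def in_keys_iff)
  ultimately show ?thesis by force
qed

lemma sc_commute: "sc a * x = x * sc a" for x :: "('a::comm_ring_1, 'b) free_alg"
  by (induction x rule: free_alg_induct) (simp_all add: algebra_simps)

lemma mult_sc_left: "x * (sc a * y) = sc a * (x * y)" for x :: "('a::comm_ring_1, 'b) free_alg"
  unfolding mult.assoc[symmetric] sc_commute[of a x] ..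

lemma sc_mult_sc: "sc a * (sc b * x) = sc (a * b) * x" for x :: "('a::comm_ring_1, 'b) free_alg"
  unfolding mult.assoc[symmetric] by simp

lemma lookup_sc_mult [simp]: "Poly_Mapping.lookup (sc a * x) w = a * Poly_Mapping.lookup x w"
  by (induction x rule: free_alg_induct) (simp_all add: lookup_add lookup_single when_def algebra_simps)

lemma lookup_mult_Nil [simp]:
  "Poly_Mapping.lookup (x * y) [] = Poly_Mapping.lookup x [] * Poly_Mapping.lookup y []"
  for x :: "('a::comm_ring_1, 'b) free_alg"
proof (induction x rule: free_alg_induct)
  case (single w)
  show ?case
    by (induction y rule: free_alg_induct) (simp_all add: lookup_add lookup_single when_def algebra_simps)
qed (simp_all add: lookup_add algebra_simps)

section \<open>Linear extension from words, grade involution and contraction\<close>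

definition lin_ext :: "('b list \<Rightarrow> ('a, 'b) free_alg) \<Rightarrow> ('a::comm_ring_1, 'b) free_alg \<Rightarrow> ('a, 'b) free_alg" where
  "lin_ext f x = (\<Sum>w\<in>Poly_Mapping.keys x. sc (Poly_Mapping.lookup x w) * f w)"

lemma lin_ext_0 [simp]: "lin_ext f 0 = 0"
  by (simp add: lin_ext_def)

lemma lin_ext_single [simp]: "lin_ext f (Poly_Mapping.single w a) = sc a * f w"
  by (simp add: lin_ext_def)

lemma lin_ext_add [simp]: "lin_ext f (x + y) = lin_ext f x + lin_ext f y"
  unfolding lin_ext_def
  by (rule setsum_keys_plus_distrib) (simp_all add: single_add distrib_right)

lemma lin_ext_sc [simp]: "lin_ext f (sc a * x) = sc a * lin_ext f x"
  by (induction x rule: free_alg_induct) (simp_all add: distrib_left flip: mult.assoc)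

lemma lin_ext_uminus [simp]: "lin_ext f (- x) = - lin_ext f x"
  using lin_ext_add[of f "- x" x] by (simp add: eq_neg_iff_add_eq_0)

lemma lin_ext_diff [simp]: "lin_ext f (x - y) = lin_ext f x - lin_ext f y"
  using lin_ext_add[of f x "- y"] by simp

definition grade_inv :: "('a::comm_ring_1, 'b) free_alg \<Rightarrow> ('a, 'b) free_alg" where
  "grade_inv = lin_ext (\<lambda>w. Poly_Mapping.single w ((- 1) ^ length w))"

text \<open>The interior product with \<phi>: the minus sign is the price for passing \<phi> over
  one letter.\<close>

primrec contr_word :: "('b \<Rightarrow> 'a) \<Rightarrow> 'b list \<Rightarrow> ('a::comm_ring_1, 'b) free_alg" where
  "contr_word \<phi> [] = 0"
| "contr_word \<phi> (v # w) = Poly_Mapping.single w (\<phi> v) - wd [v] * contr_word \<phi> w"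

definition contr :: "('b \<Rightarrow> 'a) \<Rightarrow> ('a::comm_ring_1, 'b) free_alg \<Rightarrow> ('a, 'b) free_alg" where
  "contr \<phi> = lin_ext (contr_word \<phi>)"

lemma
  shows contr_0 [simp]: "contr \<phi> 0 = 0"
    and contr_add [simp]: "contr \<phi> (x + y) = contr \<phi> x + contr \<phi> y"
    and contr_sc [simp]: "contr \<phi> (sc a * x) = sc a * contr \<phi> x"
    and contr_uminus [simp]: "contr \<phi> (- x) = - contr \<phi> x"
    and contr_diff [simp]: "contr \<phi> (x - y) = contr \<phi> x - contr \<phi> y"
    and contr_single [simp]: "contr \<phi> (Poly_Mapping.single w a) = sc a * contr_word \<phi> w"
  by (simp_all add: contr_def)

lemma
  shows grade_inv_0 [simp]: "grade_inv 0 = 0"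
    and grade_inv_add [simp]: "grade_inv (x + y) = grade_inv x + grade_inv y"
    and grade_inv_diff [simp]: "grade_inv (x - y) = grade_inv x - grade_inv y"
    and grade_inv_single [simp]:
      "grade_inv (Poly_Mapping.single w a) = Poly_Mapping.single w ((- 1) ^ length w * a)"
  by (simp_all add: grade_inv_def mult.commute)

lemma grade_inv_mult [simp]: "grade_inv (x * y) = grade_inv x * grade_inv y"
proof (induction x rule: free_alg_induct)
  case (single w)
  show ?case
    by (induction y rule: free_alg_induct) (simp_all add: power_add algebra_simps)
qed (simp_all add: algebra_simps)

lemma contr_word_append:
  "contr_word \<phi> (v @ w) = contr_word \<phi> v * wd w + Poly_Mapping.single v ((- 1) ^ length v) * contr_word \<phi> w"
proof (induction v)
  case Nil
  then show ?case by (simp add: sc_1)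
next
  case (Cons a v)
  have "wd [a] * (Poly_Mapping.single v ((- 1) ^ length v) * contr_word \<phi> w)
     = Poly_Mapping.single (a # v) ((- 1) ^ length v) * contr_word \<phi> w"
    by (simp flip: mult.assoc)
  then show ?case
    by (simp add: Cons algebra_simps single_uminus)
qed

text \<open>The graded Leibniz rule. On monomials it is \<open>contr_word_append\<close>; since
  scalars are central, it extends bilinearly.\<close>

lemma contr_mult: "contr \<phi> (x * y) = contr \<phi> x * y + grade_inv x * contr \<phi> y"
proof (induction x rule: free_alg_induct)
  case (single v)
  define a where "a = Poly_Mapping.lookup x v"
  have "contr \<phi> (Poly_Mapping.single v a * y)
      = sc a * (contr_word \<phi> v * y) + Poly_Mapping.single v ((- 1) ^ length v * a) * contr \<phi> y"
  proof (induction y rule: free_alg_induct)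
    case (single w)
    define b where "b = Poly_Mapping.lookup y w"
    have "contr \<phi> (Poly_Mapping.single v a * Poly_Mapping.single w b) =
      sc (a * b) * (contr_word \<phi> v * wd w) + sc (a * b) * (Poly_Mapping.single v ((- 1) ^ length v) * contr_word \<phi> w)"
      by (simp add: contr_word_append distrib_left)
    also have "sc (a * b) * (contr_word \<phi> v * wd w) = sc a * (contr_word \<phi> v * Poly_Mapping.single w b)"
    proof -
      have "sc (a * b) * (contr_word \<phi> v * wd w) = sc a * (sc b * contr_word \<phi> v) * wd w"
        by (simp flip: mult.assoc)
      also have "\<dots> = sc a * (contr_word \<phi> v * sc b) * wd w"
        by (simp only: sc_commute)
      also have "\<dots> = sc a * (contr_word \<phi> v * (sc b * wd w))"
        by (simp only: mult.assoc)
      finally show ?thesis by simp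
    qed
    also have "sc (a * b) * (Poly_Mapping.single v ((- 1) ^ length v) * contr_word \<phi> w)
        = Poly_Mapping.single v ((- 1) ^ length v * a) * (sc b * contr_word \<phi> w)"
      by (simp add: mult_ac flip: mult.assoc)
    finally show ?case by (simp add: b_def)
  qed (simp_all add: algebra_simps)
  then show ?case by (simp add: a_def algebra_simps)
qed (simp_all add: algebra_simps)

subsection \<open>Graded pieces of the free algebra\<close>

definition hom_part :: "int \<Rightarrow> ('a::comm_ring_1, 'b) free_alg set" where
  "hom_part p = {x. \<forall>w\<in>Poly_Mapping.keys x. int (length w) = p}"

text \<open>The words of length \<open>p\<close> whose first \<open>q\<close> letters lie in \<open>\<Omega>\<close> span the products of \<open>q\<close> vectors
  of \<open>\<Omega>\<close> with arbitrary elements of degree \<open>p - q\<close>.\<close>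

definition prefix_part :: "'b set \<Rightarrow> nat \<Rightarrow> int \<Rightarrow> ('a::comm_ring_1, 'b) free_alg set" where
  "prefix_part \<Omega> q p =
     {x. \<forall>w\<in>Poly_Mapping.keys x. int (length w) = p \<and> q \<le> length w \<and> set (take q w) \<subseteq> \<Omega>}"

text \<open>These elements play the role of zero in degree p over A/K; they are the correction terms
  \<kappa> in all later congruences.\<close>

definition coeff_part :: "'a set \<Rightarrow> int \<Rightarrow> ('a::comm_ring_1, 'b) free_alg set" where
  "coeff_part K p = {x \<in> hom_part p. \<forall>w. Poly_Mapping.lookup x w \<in> K}"

lemma prefix_part_0_eq: "prefix_part \<Omega> 0 p = hom_part p"
  by (simp add: prefix_part_def hom_part_def)

lemma prefix_part_subset_hom_part: "prefix_part \<Omega> q p \<subseteq> hom_part p"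
  by (auto simp: prefix_part_def hom_part_def)

lemma
  shows prefix_part_0 [simp]: "0 \<in> prefix_part \<Omega> q p"
    and prefix_part_add: "x \<in> prefix_part \<Omega> q p \<Longrightarrow> y \<in> prefix_part \<Omega> q p \<Longrightarrow> x + y \<in> prefix_part \<Omega> q p"
    and prefix_part_diff: "x \<in> prefix_part \<Omega> q p \<Longrightarrow> y \<in> prefix_part \<Omega> q p \<Longrightarrow> x - y \<in> prefix_part \<Omega> q p"
    and prefix_part_sc: "x \<in> prefix_part \<Omega> q p \<Longrightarrow> sc a * x \<in> prefix_part \<Omega> q p"
    and prefix_part_single: "int (length w) = p \<Longrightarrow> q \<le> length w \<Longrightarrow> set (take q w) \<subseteq> \<Omega> \<Longrightarrow>
      Poly_Mapping.single w a \<in> prefix_part \<Omega> q p"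
  using keys_add[of x y] keys_diff[of x y]
  by (auto simp: prefix_part_def in_keys_iff lookup_single when_def)

lemmas hom_part_0 [simp] = prefix_part_0[of "{}" 0, unfolded prefix_part_0_eq]
  and hom_part_add = prefix_part_add[of _ "{}" 0, unfolded prefix_part_0_eq]
  and hom_part_diff = prefix_part_diff[of _ "{}" 0, unfolded prefix_part_0_eq]
  and hom_part_sc = prefix_part_sc[of _ "{}" 0, unfolded prefix_part_0_eq]
  and hom_part_single = prefix_part_single[of _ _ 0 "{}", unfolded prefix_part_0_eq, simplified]

lemma prefix_part_induct [consumes 1, case_names zero single add]:
  assumes "x \<in> prefix_part \<Omega> q p" "P 0"
    "\<And>w a. int (length w) = p \<Longrightarrow> q \<le> length w \<Longrightarrow> set (take q w) \<subseteq> \<Omega> \<Longrightarrow> P (Poly_Mapping.single w a)"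
    "\<And>x y. P x \<Longrightarrow> P y \<Longrightarrow> P (x + y)"
  shows "P x"
  by (rule free_alg_induct[of P x]) (use assms in \<open>auto simp: prefix_part_def\<close>)

lemma hom_part_induct [consumes 1, case_names zero single add]:
  assumes "x \<in> hom_part p" "P 0"
    "\<And>w a. int (length w) = p \<Longrightarrow> P (Poly_Mapping.single w a)"
    "\<And>x y. P x \<Longrightarrow> P y \<Longrightarrow> P (x + y)"
  shows "P x"
  by (rule free_alg_induct[of P x]) (use assms in \<open>auto simp: hom_part_def\<close>)

lemma prefix_part_mono: "q \<le> q' \<Longrightarrow> prefix_part \<Omega> q' p \<subseteq> prefix_part \<Omega> q p"
  using set_take_subset_set_take[of q q'] by (fastforce simp: prefix_part_def)

lemma prefix_part_sum:
  assumes "\<And>i. i \<in> A \<Longrightarrow> f i \<in> prefix_part \<Omega> q p"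
  shows "sum f A \<in> prefix_part \<Omega> q p"
  using assms by (induction A rule: infinite_finite_induct) (auto intro: prefix_part_add)

lemma hom_part_neg: "x \<in> hom_part p \<Longrightarrow> p < 0 \<Longrightarrow> x = 0"
  by (induction x rule: hom_part_induct) auto

lemma prefix_part_short: "x \<in> prefix_part \<Omega> q p \<Longrightarrow> p < int q \<Longrightarrow> x = 0"
  by (induction x rule: prefix_part_induct) auto

lemma hom_part_0_eq_sc: "x \<in> hom_part 0 \<Longrightarrow> x = sc (Poly_Mapping.lookup x [])"
  by (induction x rule: hom_part_induct) (auto simp: lookup_add single_add)

lemma grade_inv_hom_part: "x \<in> hom_part (int j) \<Longrightarrow> grade_inv x = sc ((- 1) ^ j) * x"
  by (induction x rule: hom_part_induct) (auto simp: distrib_left)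

lemma word_mult_prefix_part:
  assumes "x \<in> prefix_part \<Omega> q p" "set v \<subseteq> \<Omega>"
  shows "Poly_Mapping.single v a * x \<in> prefix_part \<Omega> (length v + q) (int (length v) + p)"
  using assms
  by (induction x rule: prefix_part_induct)
    (auto simp: distrib_left intro!: prefix_part_add prefix_part_single)

lemma word_mult_hom_part:
  assumes "x \<in> hom_part p"
  shows "Poly_Mapping.single v a * x \<in> hom_part (int (length v) + p)"
  using assms
  by (induction x rule: hom_part_induct)
    (auto simp: distrib_left intro!: hom_part_add hom_part_single)

lemma prefix_part_mult_hom_part:
  assumes "x \<in> prefix_part \<Omega> q p" "z \<in> hom_part p'"
  shows "x * z \<in> prefix_part \<Omega> q (p + p')"
  using assms(1)
proof (induction x rule: prefix_part_induct)
  case (single w a)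
  from assms(2) show ?case
    by (induction z rule: hom_part_induct)
      (use single in \<open>auto simp: distrib_left intro!: prefix_part_add prefix_part_single\<close>)
qed (auto simp: distrib_right intro!: prefix_part_add)

text \<open>Each term of a contraction loses exactly one letter, hence at most one of the leading
  letters from \<Omega>. Truncated subtraction makes q = 0 the plain degree statement.\<close>

lemma contr_word_prefix_part:
  assumes "int (length w) = p" "q \<le> length w" "set (take q w) \<subseteq> \<Omega>"
  shows "contr_word \<phi> w \<in> prefix_part \<Omega> (q - 1) (p - 1)"
  using assms
proof (induction w arbitrary: q p)
  case (Cons v w)
  have "Poly_Mapping.single w (\<phi> v) \<in> prefix_part \<Omega> (q - 1) (p - 1)"
    using Cons.prems by (intro prefix_part_single) (cases q; auto)+
  moreover have "wd [v] * contr_word \<phi> w \<in> prefix_part \<Omega> (q - 1) (p - 1)"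
  \<comment> \<open>For q \<le> 1 only the degree is claimed. Otherwise the letter v, itself in
    \<Omega>, restores the one that the contraction of the tail may lose.\<close>
  proof (cases "q \<le> 1")
    case True
    have "contr_word \<phi> w \<in> hom_part (p - 1 - 1)"
      using Cons.IH[of "p - 1" 0] Cons.prems by (simp add: prefix_part_0_eq)
    from word_mult_hom_part[OF this, of "[v]" 1] True show ?thesis
      by (simp add: prefix_part_0_eq)
  next
    case False
    then obtain q' where q: "q = Suc (Suc q')"
      by (metis One_nat_def Suc_le_D not_less_eq_eq)
    have "contr_word \<phi> w \<in> prefix_part \<Omega> q' (p - 1 - 1)"
      using Cons.IH[of "p - 1" "Suc q'"] Cons.prems by (simp add: q)
    from word_mult_prefix_part[OF this, of "[v]" 1] Cons.prems show ?thesis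
      by (simp add: q)
  qed
  ultimately show ?case
    by (simp add: prefix_part_diff)
qed auto

lemma contr_prefix_part:
  assumes "x \<in> prefix_part \<Omega> q p"
  shows "contr \<phi> x \<in> prefix_part \<Omega> (q - 1) (p - 1)"
  using assms
  by (induction x rule: prefix_part_induct)
    (auto intro!: prefix_part_add prefix_part_sc contr_word_prefix_part simp del: One_nat_def)

lemmas contr_hom_part = contr_prefix_part[of _ "{}" 0, unfolded prefix_part_0_eq, simplified, unfolded prefix_part_0_eq]

lemma fold_contr_prefix_part:
  assumes "x \<in> prefix_part \<Omega> q p"
  shows "fold contr F x \<in> prefix_part \<Omega> (q - length F) (p - int (length F))"
  using assms
proof (induction F arbitrary: x q p)
  case (Cons \<phi> F)
  from Cons.IH[OF contr_prefix_part[OF Cons.prems, of \<phi>]] show ?case by (simp add: algebra_simps)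
qed simp

lemma foldr_contr_hom_part:
  assumes "x \<in> hom_part p"
  shows "foldr contr F x \<in> hom_part (p - int (length F))"
proof (induction F)
  case (Cons \<phi> F)
  from contr_hom_part[OF this, of \<phi>] show ?case by (simp add: algebra_simps)
qed (simp add: assms)

lemma
  shows fold_contr_0 [simp]: "fold contr F 0 = 0"
    and fold_contr_add [simp]: "fold contr F (x + y) = fold contr F x + fold contr F y"
    and fold_contr_diff [simp]: "fold contr F (x - y) = fold contr F x - fold contr F y"
    and fold_contr_sc [simp]: "fold contr F (sc a * x) = sc a * fold contr F x"
  by (induction F arbitrary: x y) auto

text \<open>If some contraction falls on z, at most j - 1 of the j letters of x are contracted away,
  so a letter from \<Omega> stays in front.\<close>

lemma fold_contr_mult_prefix_part:
  assumes "x \<in> prefix_part \<Omega> j (int j)" "z \<in> hom_part p" "length F = j"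
  shows "fold contr F (x * z) - fold contr F x * z \<in> prefix_part \<Omega> 1 p"
  using assms
proof (induction F arbitrary: x j)
  case (Cons \<phi> F)
  then obtain i where j: "j = Suc i" by auto
  have x: "grade_inv x = sc ((- 1) ^ j) * x"
    using Cons.prems(1) prefix_part_subset_hom_part by (blast intro: grade_inv_hom_part)
  have "x * contr \<phi> z \<in> prefix_part \<Omega> j (int j + (p - 1))"
    using Cons.prems by (intro prefix_part_mult_hom_part contr_hom_part)
  from fold_contr_prefix_part[OF this, of F]
  have "sc ((- 1) ^ j) * fold contr F (x * contr \<phi> z) \<in> prefix_part \<Omega> 1 p"
    using Cons.prems(3) by (intro prefix_part_sc) (simp add: j)
  moreover have "contr \<phi> x \<in> prefix_part \<Omega> i (int i)"
    using contr_prefix_part[OF Cons.prems(1), of \<phi>] by (simp add: j)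
  then have "fold contr F (contr \<phi> x * z) - fold contr F (contr \<phi> x) * z \<in> prefix_part \<Omega> 1 p"
    using Cons.prems j by (intro Cons.IH) auto
  ultimately show ?case
    using prefix_part_add by (fastforce simp: contr_mult x mult.assoc algebra_simps)
qed simp

section \<open>Elements with coefficients in an ideal, and enlarging that ideal by one
  element\<close>

lemma coeff_part_induct [consumes 1, case_names zero single add]:
  assumes "x \<in> coeff_part K p" "P 0"
    "\<And>w k. k \<in> K \<Longrightarrow> int (length w) = p \<Longrightarrow> P (Poly_Mapping.single w k)"
    "\<And>x y. P x \<Longrightarrow> P y \<Longrightarrow> P (x + y)"
  shows "P x"
  by (rule free_alg_induct[of P x]) (use assms in \<open>auto simp: coeff_part_def hom_part_def\<close>)

text \<open>The ideal K + (x), in a form that splits each coefficient into a part in K and a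
  multiple of x.\<close>

definition adjoin :: "'a::comm_ring_1 set \<Rightarrow> 'a \<Rightarrow> 'a set" where
  "adjoin K x = {k + x * a | k a. k \<in> K}"

context
  fixes K :: "'a::comm_ring_1 set"
  assumes K: "ideal K ring_of_type_algebra"
begin

lemma
  shows coeff_part_0 [simp]: "0 \<in> coeff_part K p"
    and coeff_part_add: "x \<in> coeff_part K p \<Longrightarrow> y \<in> coeff_part K p \<Longrightarrow> x + y \<in> coeff_part K p"
    and coeff_part_diff: "x \<in> coeff_part K p \<Longrightarrow> y \<in> coeff_part K p \<Longrightarrow> x - y \<in> coeff_part K p"
    and coeff_part_sc: "x \<in> coeff_part K p \<Longrightarrow> sc a * x \<in> coeff_part K p"
    and coeff_part_sc_mem: "x \<in> hom_part p \<Longrightarrow> k \<in> K \<Longrightarrow> sc k * x \<in> coeff_part K p"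
  using type_ideal_0[OF K] type_ideal_add[OF K] type_ideal_diff[OF K] type_ideal_lmult[OF K] type_ideal_rmult[OF K]
  by (simp_all add: coeff_part_def hom_part_add hom_part_diff hom_part_sc lookup_add lookup_minus)

lemma word_mult_coeff_part:
  assumes "x \<in> coeff_part K p"
  shows "wd v * x \<in> coeff_part K (int (length v) + p)"
  using assms
proof (induction x rule: coeff_part_induct)
  case (single w k)
  then show ?case
    using coeff_part_sc_mem[of "wd (v @ w)" "int (length v) + p" k] by (simp add: hom_part_single)
qed (auto simp: distrib_left intro: coeff_part_add)

lemma contr_coeff_part:
  assumes "x \<in> coeff_part K p"
  shows "contr \<phi> x \<in> coeff_part K (p - 1)"
  using assms
proof (induction x rule: coeff_part_induct)
  case (single w k)
  then show ?case
    using coeff_part_sc_mem[of "contr_word \<phi> w" "p - 1" k] contr_hom_part[of "wd w" p \<phi>]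
    by (simp add: hom_part_single sc_1)
qed (auto intro: coeff_part_add)

lemma fold_contr_coeff_part:
  assumes "x \<in> coeff_part K p"
  shows "fold contr F x \<in> coeff_part K (p - int (length F))"
  using assms
proof (induction F arbitrary: x p)
  case (Cons \<phi> F)
  from Cons.IH[OF contr_coeff_part[OF Cons.prems, of \<phi>]] show ?case by (simp add: algebra_simps)
qed simp

lemma ideal_adjoin: "ideal (adjoin K x) ring_of_type_algebra"
proof -
  have "0 + x * 0 \<in> adjoin K x"
    unfolding adjoin_def using type_ideal_0[OF K] by blast
  moreover have "(k + x * a) + (l + x * b) \<in> adjoin K x" if "k \<in> K" "l \<in> K" for k l a b
  proof -
    have "(k + x * a) + (l + x * b) = (k + l) + x * (a + b)" by (simp add: algebra_simps)
    then show ?thesis unfolding adjoin_def using type_ideal_add[OF K that] by blast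
  qed
  moreover have "c * (k + x * a) \<in> adjoin K x" if "k \<in> K" for k a c
  proof -
    have "c * (k + x * a) = c * k + x * (c * a)" by (simp add: algebra_simps)
    then show ?thesis unfolding adjoin_def using type_ideal_lmult[OF K that] by blast
  qed
  ultimately show ?thesis
    unfolding ideal_ring_of_type_algebra_iff
    by (auto simp: mult.commute) (auto simp: adjoin_def mult.commute)
qed

lemma subset_adjoin: "K \<subseteq> adjoin K x"
proof
  fix k
  assume "k \<in> K"
  moreover have "k = k + x * 0" by simp
  ultimately show "k \<in> adjoin K x" unfolding adjoin_def by blast
qed

lemma mem_adjoin: "x \<in> adjoin K x"
proof -
  have "x = 0 + x * 1" by simp
  then show ?thesis unfolding adjoin_def using type_ideal_0[OF K] by blast
qed

lemma coeff_part_adjoin: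
  assumes "y \<in> coeff_part (adjoin K x) p"
  obtains \<kappa> \<gamma> where "\<kappa> \<in> coeff_part K p" "\<gamma> \<in> hom_part p" "y = \<kappa> + sc x * \<gamma>"
proof -
  have "\<exists>\<kappa>\<in>coeff_part K p. \<exists>\<gamma>\<in>hom_part p. y = \<kappa> + sc x * \<gamma>"
    using assms
  proof (induction y rule: coeff_part_induct)
    case zero
    show ?case by (rule bexI[of _ 0], rule bexI[of _ 0]) auto
  next
    case (single w k)
    then obtain l a where la: "l \<in> K" "k = l + x * a" by (auto simp: adjoin_def)
    moreover from la have "Poly_Mapping.single w l \<in> coeff_part K p"
      using coeff_part_sc_mem[of "wd w" p l] single by (simp add: hom_part_single)
    moreover have "Poly_Mapping.single w a \<in> hom_part p"
      using single by (simp add: hom_part_single)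
    moreover have "Poly_Mapping.single w k = Poly_Mapping.single w l + sc x * Poly_Mapping.single w a"
      by (simp add: la single_add)
    ultimately show ?case by blast
  next
    case (add y z)
    then obtain \<kappa> \<gamma> \<kappa>' \<gamma>' where
      "\<kappa> \<in> coeff_part K p" "\<gamma> \<in> hom_part p" "y = \<kappa> + sc x * \<gamma>"
      "\<kappa>' \<in> coeff_part K p" "\<gamma>' \<in> hom_part p" "z = \<kappa>' + sc x * \<gamma>'"
      by blast
    then have "\<kappa> + \<kappa>' \<in> coeff_part K p" "\<gamma> + \<gamma>' \<in> hom_part p"
      "y + z = (\<kappa> + \<kappa>') + sc x * (\<gamma> + \<gamma>')"
      by (auto intro: coeff_part_add hom_part_add simp: distrib_left)
    then show ?case by blast
  qed
  then show ?thesis using that by blast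
qed

end

lemma coeff_part_sum:
  assumes "ideal K ring_of_type_algebra" "\<And>i. i \<in> A \<Longrightarrow> f i \<in> coeff_part K p"
  shows "sum f A \<in> coeff_part K p"
  using assms(2)
  by (induction A rule: infinite_finite_induct) (auto intro: coeff_part_0 coeff_part_add assms(1))

lemma coeff_part_zero_ideal: "x \<in> coeff_part {0} p \<Longrightarrow> x = 0"
  by (intro poly_mapping_eqI) (simp add: coeff_part_def)

subsection \<open>Calculus modulo the relations\<close>

definition lin_form :: "('a::comm_ring_1 \<Rightarrow> 'b::ab_group_add \<Rightarrow> 'b) \<Rightarrow> ('b \<Rightarrow> 'a) \<Rightarrow> bool" where
  "lin_form scale \<phi> \<longleftrightarrow> (\<forall>u v. \<phi> (u + v) = \<phi> u + \<phi> v) \<and> (\<forall>a v. \<phi> (scale a v) = a * \<phi> v)"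

context
  fixes scale :: "'a::comm_ring_1 \<Rightarrow> 'b::ab_group_add \<Rightarrow> 'b"
begin

private abbreviation E :: "('a, 'b) free_alg set" where
  "E \<equiv> ext_ideal scale"

lemma ideal_E: "ideal E ring_of_type_algebra"
  unfolding ext_ideal_def by (rule type_Idl_ideal)

lemmas E_0 [simp] = type_ideal_0[OF ideal_E]
  and E_add = type_ideal_add[OF ideal_E]
  and E_diff = type_ideal_diff[OF ideal_E]
  and E_uminus = type_ideal_uminus[OF ideal_E]
  and E_lmult = type_ideal_lmult[OF ideal_E]
  and E_rmult = type_ideal_rmult[OF ideal_E]

lemma
  shows E_word_add: "wd [u + v] - wd [u] - wd [v] \<in> E"
    and E_word_scale: "wd [scale a v] - Poly_Mapping.single [v] a \<in> E"
    and E_word_square: "wd [v, v] \<in> E"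
  using type_Idl_superset[of "ext_relations scale"]
  unfolding ext_ideal_def ext_relations_def by blast+

lemma E_trans: "x - y \<in> E \<Longrightarrow> y - z \<in> E \<Longrightarrow> x - z \<in> E"
  using E_add[of "x - y" "y - z"] by simp

lemma E_mem_cong: "x - y \<in> E \<Longrightarrow> x \<in> E \<longleftrightarrow> y \<in> E"
  using E_add[of "x - y" y] E_diff[of x "x - y"] by auto

lemma E_lmult_cong: "x - y \<in> E \<Longrightarrow> z * x - z * y \<in> E"
  using E_lmult[of "x - y" z] by (simp add: algebra_simps)

lemma E_rmult_cong: "x - y \<in> E \<Longrightarrow> x * z - y * z \<in> E"
  using E_rmult[of "x - y" z] by (simp add: algebra_simps)

text \<open>The elements of the ideal whose contraction and grade involution stay in the ideal form an ideal,
  because both maps satisfy product rules.\<close>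

lemma E_contr:
  assumes "lin_form scale \<phi>" "x \<in> E"
  shows "contr \<phi> x \<in> E"
proof -
  define J where "J = {x \<in> E. grade_inv x \<in> E \<and> contr \<phi> x \<in> E}"
  have "ideal J ring_of_type_algebra"
    unfolding ideal_ring_of_type_algebra_iff J_def
    by (auto simp: contr_mult intro: E_add E_lmult E_rmult)
  moreover have "ext_relations scale \<subseteq> J"
  proof
    fix y
    assume y: "y \<in> ext_relations scale"
    then have yE: "y \<in> E"
      unfolding ext_ideal_def using type_Idl_superset by blast
    \<comment> \<open>Linearity of \<phi> handles the linear relations; for a square the two terms
      \<phi>(v) v cancel.\<close>
    have "contr \<phi> y = 0"
      using y assms(1) unfolding ext_relations_def
      by (auto simp: lin_form_def single_add sc_1 mult.commute)
    moreover have "y \<in> hom_part (int 1) \<or> y \<in> hom_part (int 2)"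
      using y unfolding ext_relations_def
      by (auto intro!: hom_part_diff hom_part_single)
    then have "grade_inv y \<in> E"
      using grade_inv_hom_part E_lmult[OF yE] by metis
    ultimately show "y \<in> J"
      unfolding J_def using yE by simp
  qed
  ultimately show ?thesis
    using assms(2) type_Idl_minimal unfolding ext_ideal_def J_def by blast
qed

lemma E_fold_contr:
  assumes "\<forall>\<phi>\<in>set F. lin_form scale \<phi>" "x \<in> E"
  shows "fold contr F x \<in> E"
  using assms by (induction F arbitrary: x) (auto intro: E_contr)

text \<open>Taking the constant term is a ring homomorphism, and the relations involve nonempty
  words only. Together with \<open>E_contr\<close> this makes coordinates well defined modulo the
  relations.\<close>

lemma E_lookup_Nil:
  assumes "x \<in> E"
  shows "Poly_Mapping.lookup x [] = 0"
proof -
  have "ideal {x :: ('a, 'b) free_alg. Poly_Mapping.lookup x [] = 0} ring_of_type_algebra"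
    unfolding ideal_ring_of_type_algebra_iff by (auto simp: lookup_add)
  moreover have "ext_relations scale \<subseteq> {x. Poly_Mapping.lookup x [] = 0}"
    by (auto simp: ext_relations_def lookup_minus lookup_single)
  ultimately show ?thesis
    using assms type_Idl_minimal unfolding ext_ideal_def by blast
qed

section \<open>Anticommutation and sorting of words modulo the relations\<close>

lemma E_word_swap: "wd [u, v] + wd [v, u] \<in> E"
proof -
  \<comment> \<open>Polarization of the square of u + v. In the free algebra the word of u + v is
    not a sum, so the defect d is carried along.\<close>
  define d :: "('a, 'b) free_alg" where "d = wd [u + v] - wd [u] - wd [v]"
  have d: "d \<in> E"
    unfolding d_def by (rule E_word_add)
  have eq: "wd [u + v] = d + wd [u] + wd [v]"
    by (simp add: d_def)
  have "wd [u + v, u + v] = wd [u + v] * wd [u + v]"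
    by simp
  also have "\<dots> = d * (d + wd [u] + wd [v]) + (wd [u] + wd [v]) * d + wd [u, u] + wd [v, v]
      + (wd [u, v] + wd [v, u])"
    unfolding eq by (simp add: algebra_simps)
  finally have "wd [u, v] + wd [v, u] =
    wd [u + v, u + v] - (d * (d + wd [u] + wd [v]) + (wd [u] + wd [v]) * d + wd [u, u] + wd [v, v])"
    by simp
  also have "\<dots> \<in> E"
    by (intro E_diff E_add E_word_square E_lmult[OF d] E_rmult[OF d])
  finally show ?thesis .
qed

lemma E_word_Cons_Cons: "wd (u # v # w) + wd (v # u # w) \<in> E"
  using E_rmult[OF E_word_swap[of u v], of "wd w"] by (simp add: distrib_right)

text \<open>Anticommutation moves the first letter to the right until it meets its copy.\<close>

lemma E_word_repeat: "v \<in> set w \<Longrightarrow> wd (v # w) \<in> E"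
proof (induction w)
  case (Cons u w)
  show ?case
  proof (cases "v = u")
    case True
    then show ?thesis
      using E_rmult[OF E_word_square[of v], of "wd w"] by simp
  next
    case False
    then have "wd (v # w) \<in> E" using Cons by simp
    from E_lmult[OF this, of "wd [u]"] have "wd (u # v # w) \<in> E" by simp
    with E_word_Cons_Cons[of v u w] E_diff show ?thesis by fastforce
  qed
qed simp

lemma E_word_not_distinct:
  assumes "\<not> distinct w"
  shows "wd w \<in> E"
proof -
  obtain xs ys zs v where w: "w = xs @ [v] @ ys @ [v] @ zs"
    using not_distinct_decomp[OF assms] by blast
  have "wd (v # ys @ [v] @ zs) \<in> E" by (rule E_word_repeat) simp
  from E_lmult[OF this, of "wd xs"] show ?thesis by (simp add: w)
qed

text \<open>Insertion is a chain of adjacent swaps, each costing a sign. Indices are sorted because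
  vectors carry no order, and s is recorded as 1 or -1 so that it can be inverted.\<close>

lemma E_word_insort:
  "\<exists>s\<in>{1, -1}. wd (f i # map f l) - sc s * wd (map f (insort i l)) \<in> E"
proof (induction l)
  case (Cons j l)
  show ?case
  proof (cases "i \<le> j")
    case False
    from Cons obtain s where s: "s \<in> {1, -1}" "wd (f i # map f l) - sc s * wd (map f (insort i l)) \<in> E"
      by blast
    have "wd (f i # f j # map f l) - sc (- s) * wd (map f (insort i (j # l)))
      = (wd (f i # f j # map f l) + wd (f j # f i # map f l))
        - wd [f j] * (wd (f i # map f l) - sc s * wd (map f (insort i l)))"
      using False by (simp add: algebra_simps single_uminus)
    also have "\<dots> \<in> E"
      by (intro E_diff E_word_Cons_Cons E_lmult s)
    finally show ?thesis using s(1) by fastforce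
  qed (auto simp: intro!: bexI[of _ 1])
qed (auto intro!: bexI[of _ 1])

lemma E_word_sort:
  "\<exists>s\<in>{1, -1}. wd (map f l) - sc s * wd (map f (sort l)) \<in> E"
proof (induction l)
  case (Cons i l)
  then obtain s where s: "s \<in> {1, -1}" "wd (map f l) - sc s * wd (map f (sort l)) \<in> E"
    by blast
  obtain t where t: "t \<in> {1, -1}" "wd (f i # map f (sort l)) - sc t * wd (map f (insort i (sort l))) \<in> E"
    using E_word_insort[of f i "sort l"] by blast
  have "wd (map f (i # l)) - sc (s * t) * wd (map f (sort (i # l)))
     = wd [f i] * (wd (map f l) - sc s * wd (map f (sort l)))
       + sc s * (wd (f i # map f (sort l)) - sc t * wd (map f (insort i (sort l))))"
    by (simp add: algebra_simps)
  also have "\<dots> \<in> E"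
    by (intro E_add E_lmult s t)
  finally show ?case using s(1) t(1) by fastforce
qed (auto intro!: bexI[of _ 1])

text \<open>All letters of x lie in \<Omega>, and the last one already kills y.\<close>

lemma E_annihilated:
  assumes "\<And>v. v \<in> \<Omega> \<Longrightarrow> wd [v] * y \<in> E" "x \<in> prefix_part \<Omega> j (int j)" "0 < j"
  shows "x * y \<in> E"
  using assms(2)
proof (induction x rule: prefix_part_induct)
  case (single w a)
  with assms(3) obtain w' v where w: "w = w' @ [v]"
    by (metis length_greater_0_conv nat_int rev_exhaust)
  have "Poly_Mapping.single w a * y = Poly_Mapping.single w' a * (wd [v] * y)"
    by (simp add: w flip: mult.assoc)
  also have "\<dots> \<in> E"
    using single w by (intro E_lmult assms(1)) auto
  finally show ?case .
qed (auto simp: distrib_right intro: E_add)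

text \<open>Integration by parts: as long as letters of x remain, the product is zero, and
  contracting this zero moves one form from y to x up to sign. The order of the forms is reversed on
  the way, hence \<open>foldr\<close> on one side and \<open>fold\<close> on the other.\<close>

lemma E_mult_foldr_contr:
  assumes y: "\<And>v. v \<in> \<Omega> \<Longrightarrow> wd [v] * y \<in> E"
    and "\<forall>\<phi>\<in>set F. lin_form scale \<phi>" "x \<in> prefix_part \<Omega> j (int j)" "length F \<le> j"
  shows "\<exists>s. x * foldr contr F y - sc s * (fold contr F x * y) \<in> E \<and> s \<in> {1, -1}"
  using assms(2-)
proof (induction F arbitrary: x j)
  case Nil
  show ?case by (auto simp: sc_1 intro!: exI[of _ 1])
next
  case (Cons \<phi> F)
  define z where "z = foldr contr F y"
  have \<phi>: "lin_form scale \<phi>" and F: "\<forall>\<phi>\<in>set F. lin_form scale \<phi>" and lF: "length F < j"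
    using Cons.prems by auto
  from Cons.IH[OF F Cons.prems(2)] lF obtain s where
    "x * z - sc s * (fold contr F x * y) \<in> E"
    unfolding z_def by auto
  \<comment> \<open>Fewer than j contractions leave at least one letter from \<Omega> next to
    y.\<close>
  moreover have "fold contr F x * y \<in> E"
  proof (rule E_annihilated[OF y])
    show "fold contr F x \<in> prefix_part \<Omega> (j - length F) (int (j - length F))"
      using fold_contr_prefix_part[OF Cons.prems(2), of F] lF by (simp add: of_nat_diff)
  qed (use lF in auto)
  ultimately have "x * z \<in> E"
    using E_mem_cong E_lmult by blast
  then have 1: "contr \<phi> x * z + sc ((- 1) ^ j) * (x * contr \<phi> z) \<in> E"
    using E_contr[OF \<phi>, of "x * z"] grade_inv_hom_part[of x j] Cons.prems(2) prefix_part_subset_hom_part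
    by (fastforce simp: contr_mult mult.assoc)
  have "contr \<phi> x \<in> prefix_part \<Omega> (j - 1) (int (j - 1))"
    using contr_prefix_part[OF Cons.prems(2), of \<phi>] lF by (simp add: of_nat_diff)
  moreover have "length F \<le> j - 1"
    using lF by simp
  ultimately obtain t where
    t: "t \<in> {1, -1}" "contr \<phi> x * z - sc t * (fold contr F (contr \<phi> x) * y) \<in> E"
    unfolding z_def using Cons.IH[OF F] by blast
  define g where "g = fold contr F (contr \<phi> x) * y"
  define e where "e = (- 1 :: 'a) ^ j"
  have e: "e * e = 1" "e \<in> {1, -1}"
    by (auto simp: e_def minus_one_power_iff simp flip: power_add mult_2)
  have "sc e * (sc e * (x * contr \<phi> z)) = x * contr \<phi> z"
    using e by (simp add: sc_1 flip: mult.assoc)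
  then have "x * contr \<phi> z - sc (- e * t) * g =
    sc e * ((contr \<phi> x * z + sc e * (x * contr \<phi> z)) - (contr \<phi> x * z - sc t * g))"
    by (simp add: algebra_simps single_uminus flip: mult.assoc)
  also have "\<dots> \<in> E"
    using 1 t(2) unfolding e_def g_def by (intro E_lmult[OF E_diff])
  finally show ?case
    using e(2) t(1) by (intro exI[of _ "- e * t"]) (auto simp: z_def g_def)
qed

end

subsection \<open>Coordinates in the exterior algebra of a free module\<close>

locale free_module = Modules.module scale
  for scale :: "'a::comm_ring_1 \<Rightarrow> 'b::ab_group_add \<Rightarrow> 'b" +
  fixes n :: nat and e :: "nat \<Rightarrow> 'b"
  assumes basis: "free_basis scale n e"
begin

abbreviation "E \<equiv> ext_ideal scale"

definition dual :: "nat \<Rightarrow> 'b \<Rightarrow> 'a" where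
  "dual i v = representation (e ` {1..n}) v (e i)"

definition basis_word :: "nat set \<Rightarrow> ('a, 'b) free_alg" where
  "basis_word S = wd (map e (sorted_list_of_set S))"

text \<open>In degree \<open>card S\<close> these contractions leave a scalar; taking the constant
  term turns this into a functional on the whole free algebra.\<close>

definition coord :: "nat set \<Rightarrow> ('a, 'b) free_alg \<Rightarrow> 'a" where
  "coord S x = Poly_Mapping.lookup (fold contr (map dual (sorted_list_of_set S)) x) []"

abbreviation subsets :: "nat \<Rightarrow> nat set set" where
  "subsets p \<equiv> {S. S \<subseteq> {1..n} \<and> card S = p}"

lemma
  shows inj_e: "inj_on e {1..n}"
    and indep_e: "independent (e ` {1..n})"
    and span_e: "v \<in> span (e ` {1..n})"
  using basis by (auto simp: free_basis_def)

lemma lin_form_dual: "lin_form scale (dual i)"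
  unfolding lin_form_def dual_def
  by (simp only: representation_add[OF indep_e span_e span_e] representation_scale[OF indep_e span_e] simp_thms)

lemma dual_e: "i \<in> {1..n} \<Longrightarrow> j \<in> {1..n} \<Longrightarrow> dual i (e j) = (if i = j then 1 else 0)"
  unfolding dual_def using representation_basis[OF indep_e, of "e j"] inj_on_eq_iff[OF inj_e] by simp

lemma sum_dual: "(\<Sum>i\<in>{1..n}. scale (dual i v) (e i)) = v"
proof -
  have "(\<Sum>b\<in>e ` {1..n}. scale (representation (e ` {1..n}) v b) b) = v"
    by (rule sum_representation_eq) (use indep_e span_e in auto)
  then show ?thesis
    by (simp add: sum.reindex[OF inj_e] dual_def del: One_nat_def)
qed

lemma E_word_sum: "finite A \<Longrightarrow>
  wd [(\<Sum>i\<in>A. scale (a i) (f i))] - (\<Sum>i\<in>A. Poly_Mapping.single [f i] (a i)) \<in> E"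
proof (induction A rule: finite_induct)
  case empty
  \<comment> \<open>The word of the zero vector is a relation, by scaling with 0.\<close>
  show ?case using E_word_scale[where scale = scale and a = 0 and v = 0] by simp
next
  case (insert i A)
  define u where "u = (\<Sum>i\<in>A. scale (a i) (f i))"
  define x where "x = (\<Sum>i\<in>A. Poly_Mapping.single [f i] (a i))"
  have "wd [scale (a i) (f i) + u] - (Poly_Mapping.single [f i] (a i) + x)
    = (wd [scale (a i) (f i) + u] - wd [scale (a i) (f i)] - wd [u])
      + ((wd [scale (a i) (f i)] - Poly_Mapping.single [f i] (a i)) + (wd [u] - x))"
    by (simp add: algebra_simps)
  also have "\<dots> \<in> E"
    using insert.IH unfolding u_def x_def by (intro E_add E_word_add E_word_scale)
  finally show ?case using insert.hyps by (simp add: u_def x_def)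
qed

lemma E_word_expand: "wd [v] - (\<Sum>i\<in>{1..n}. Poly_Mapping.single [e i] (dual i v)) \<in> E"
  using E_word_sum[of "{1..n}" "\<lambda>i. dual i v" e] unfolding sum_dual by simp

section \<open>Coordinates as functionals modulo the relations, and their duality with the basis
  words\<close>

lemma coord_0 [simp]: "coord S 0 = 0"
  and coord_add [simp]: "coord S (x + y) = coord S x + coord S y"
  and coord_diff [simp]: "coord S (x - y) = coord S x - coord S y"
  and coord_sc [simp]: "coord S (sc a * x) = a * coord S x"
  by (simp_all add: coord_def lookup_add lookup_minus)

lemma coord_sum [simp]: "coord S (sum f A) = (\<Sum>i\<in>A. coord S (f i))"
  by (induction A rule: infinite_finite_induct) auto

lemma coord_E: "x \<in> E \<Longrightarrow> coord S x = 0"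
  unfolding coord_def by (intro E_lookup_Nil E_fold_contr) (auto simp: lin_form_dual)

lemma contr_dual_word_absent:
  assumes "i \<in> {1..n}" "set m \<subseteq> {1..n}" "i \<notin> set m"
  shows "contr_word (dual i) (map e m) = 0"
  using assms by (induction m) (auto simp: dual_e)

text \<open>No form in the list sees \<open>e t\<close>: every contraction passes over this letter
  with a sign, so the result keeps it in front and has no constant term.\<close>

lemma lookup_fold_contr_absent:
  assumes "t \<in> {1..n}" "set l \<subseteq> {1..n}" "t \<notin> set l"
  shows "Poly_Mapping.lookup (fold contr (map dual l) (wd [e t] * y)) [] = 0"
  using assms
proof (induction l arbitrary: y)
  case Nil
  then show ?case by (simp add: lookup_single)
next
  case (Cons s l)
  have "contr (dual s) (wd [e t] * y) = wd [e t] * (- contr (dual s) y)"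
    using Cons.prems by (auto simp: contr_mult dual_e single_uminus)
  with Cons.IH[of "- contr (dual s) y"] Cons.prems show ?case
    by (simp del: mult_minus_right)
qed

text \<open>Only the smallest indices s and t matter. If s = t, contraction removes exactly the
  first letter; if s < t, the form of s vanishes on every letter; if t < s, the letter
  \<open>e t\<close> is never removed.\<close>

lemma lookup_fold_contr_word:
  assumes "sorted_wrt (<) l" "sorted_wrt (<) m" "set l \<subseteq> {1..n}" "set m \<subseteq> {1..n}" "length l = length m"
  shows "Poly_Mapping.lookup (fold contr (map dual l) (wd (map e m))) [] = (if l = m then 1 else 0)"
  using assms(5,1-4)
proof (induction l m rule: list_induct2)
  case (Cons s l t m)
  have e: "wd (map e (t # m)) = wd [e t] * wd (map e m)" by simp
  consider "s = t" | "s < t" | "t < s" by linarith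
  then show ?case
  proof cases
    case 1
    have "contr_word (dual s) (map e m) = 0"
      using Cons.prems 1 by (intro contr_dual_word_absent) auto
    then show ?thesis
      using Cons 1 by (simp add: dual_e sc_1)
  next
    case 2
    then have "contr_word (dual s) (map e (t # m)) = 0"
      using Cons.prems by (intro contr_dual_word_absent) auto
    then show ?thesis using 2 by simp
  next
    case 3
    then have "t \<notin> set (s # l)" using Cons.prems by auto
    then have "Poly_Mapping.lookup (fold contr (map dual (s # l)) (wd [e t] * wd (map e m))) [] = 0"
      using Cons.prems by (intro lookup_fold_contr_absent) auto
    with 3 e show ?thesis by simp
  qed
qed simp

lemma coord_basis_word:
  assumes "S \<subseteq> {1..n}" "T \<subseteq> {1..n}" "card S = card T"
  shows "coord S (basis_word T) = (if S = T then 1 else 0)"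
proof -
  have "finite S" "finite T" using assms finite_subset by blast+
  with assms have "coord S (basis_word T) =
      (if sorted_list_of_set S = sorted_list_of_set T then 1 else 0)"
    unfolding coord_def basis_word_def by (intro lookup_fold_contr_word) auto
  then show ?thesis
    using \<open>finite S\<close> \<open>finite T\<close> by (metis set_sorted_list_of_set)
qed

text \<open>Stated with \<open>coord\<close> instead of unknown coefficients, the property is
  visibly closed under linear combinations and under congruence modulo the relations. Spanning then
  reduces to words.\<close>

definition expands :: "nat \<Rightarrow> ('a, 'b) free_alg \<Rightarrow> bool" where
  "expands p x \<longleftrightarrow> x - (\<Sum>S\<in>subsets p. sc (coord S x) * basis_word S) \<in> E"

lemma finite_subsets: "finite (subsets p)"
  by (rule finite_subset[of _ "Pow {1..n}"]) auto

lemma expands_0: "expands p 0"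
  by (simp add: expands_def)

lemma expands_add:
  assumes "expands p x" "expands p y"
  shows "expands p (x + y)"
  using E_add[OF assms[unfolded expands_def]]
  by (simp add: expands_def single_add distrib_right sum.distrib algebra_simps)

lemma expands_sc:
  assumes "expands p x"
  shows "expands p (sc a * x)"
  using E_lmult[OF assms[unfolded expands_def], of "sc a"]
  by (simp add: expands_def right_diff_distrib sum_distrib_left flip: mult.assoc)

lemma expands_sum: "(\<And>i. i \<in> A \<Longrightarrow> expands p (f i)) \<Longrightarrow> expands p (sum f A)"
  by (induction A rule: infinite_finite_induct) (auto intro: expands_0 expands_add)

lemma expands_cong:
  assumes "x - y \<in> E" "expands p y"
  shows "expands p x"
proof -
  have "coord S x = coord S y" for S
    using coord_E[OF assms(1), of S] by simp
  then show ?thesis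
    using E_add[OF assms(1) assms(2)[unfolded expands_def]] by (simp add: expands_def)
qed

lemma expands_basis_word:
  assumes "T \<in> subsets p"
  shows "expands p (basis_word T)"
proof -
  have "(\<Sum>S\<in>subsets p. sc (coord S (basis_word T)) * basis_word S)
      = (\<Sum>S\<in>subsets p. if S = T then basis_word T else 0)"
    using assms by (intro sum.cong) (auto simp: coord_basis_word sc_1)
  also have "\<dots> = basis_word T"
    using assms by (simp add: finite_subsets)
  finally show ?thesis by (simp add: expands_def)
qed

lemma expands_basis_Cons:
  assumes "i \<in> {1..n}" "T \<in> subsets p"
  shows "expands (Suc p) (wd [e i] * basis_word T)"
proof -
  have T: "finite T" using assms(2) finite_subset by blast
  let ?l = "i # sorted_list_of_set T"
  show ?thesis
  proof (cases "i \<in> T")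
    case True
    then have "wd (map e ?l) \<in> E"
      using T E_word_repeat[where scale = scale and v = "e i" and w = "map e (sorted_list_of_set T)"] by simp
    then show ?thesis
      using expands_cong[OF _ expands_0] by (simp add: basis_word_def)
  next
    case False
    obtain s where "wd (map e ?l) - sc s * wd (map e (sort ?l)) \<in> E"
      using E_word_sort by blast
    moreover have "sort ?l = sorted_list_of_set (insert i T)"
      using T False by (simp add: sorted_sort_id)
    moreover have "expands (Suc p) (basis_word (insert i T))"
      using assms T False by (intro expands_basis_word) auto
    ultimately have "expands (Suc p) (wd (map e ?l))"
      unfolding basis_word_def by (metis expands_cong expands_sc)
    then show ?thesis by (simp add: basis_word_def)
  qed
qed

text \<open>The first letter is expanded in the basis of M, the tail by induction, and the products
  of basis vectors are sorted.\<close>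

lemma expands_word: "expands (length w) (wd w)"
proof (induction w)
  case Nil
  have "expands 0 (basis_word {})" by (rule expands_basis_word) auto
  then show ?case by (simp add: basis_word_def)
next
  case (Cons v w)
  let ?p = "length w"
  let ?A = "\<Sum>i\<in>{1..n}. Poly_Mapping.single [e i] (dual i v)"
  let ?B = "\<Sum>S\<in>subsets ?p. sc (coord S (wd w)) * basis_word S"
  have "wd [v] * wd w - ?A * ?B \<in> E"
    using E_trans[OF E_rmult_cong[OF E_word_expand] E_lmult_cong[OF Cons[unfolded expands_def]]] .
  moreover have "?A * ?B = (\<Sum>i\<in>{1..n}. \<Sum>S\<in>subsets ?p.
      sc (dual i v) * (sc (coord S (wd w)) * (wd [e i] * basis_word S)))"
  proof -
    have "Poly_Mapping.single [e i] (dual i v) * (sc c * basis_word S)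
      = sc (dual i v) * (sc c * (wd [e i] * basis_word S))" for i c S
      by (simp add: mult.commute flip: mult.assoc)
    then show ?thesis by (simp add: sum_product)
  qed
  moreover have "expands (Suc ?p) (\<Sum>i\<in>{1..n}. \<Sum>S\<in>subsets ?p.
      sc (dual i v) * (sc (coord S (wd w)) * (wd [e i] * basis_word S)))"
    by (intro expands_sum expands_sc expands_basis_Cons)
  ultimately show ?case
    using expands_cong by simp
qed

lemma hom_part_expands:
  assumes "x \<in> hom_part (int p)"
  shows "expands p x"
  using assms
proof (induction x rule: hom_part_induct)
  case (single w a)
  then show ?case using expands_sc[OF expands_word[of w], of a] by simp
qed (auto intro: expands_0 expands_add)

lemma basis_word_hom_part: "S \<in> subsets p \<Longrightarrow> basis_word S \<in> hom_part (int p)"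
  by (auto simp: basis_word_def intro!: hom_part_single)

lemma coord_coeff_part:
  assumes "ideal K ring_of_type_algebra" "x \<in> coeff_part K p"
  shows "coord S x \<in> K"
  using fold_contr_coeff_part[OF assms, of "map dual (sorted_list_of_set S)"]
  by (simp add: coord_def coeff_part_def)

text \<open>Here freeness of the exterior powers enters: cancelling g takes place in each
  coordinate, and the basis expansion of x with its new coefficients in K is the witness.\<close>

lemma nonzerodivisor_coeff_part:
  assumes K: "ideal K ring_of_type_algebra" and nzd: "\<And>a. g * a \<in> K \<Longrightarrow> a \<in> K"
    and x: "x \<in> hom_part p" and \<kappa>: "\<kappa> \<in> coeff_part K p" "sc g * x - \<kappa> \<in> E"
  shows "\<exists>\<kappa>'\<in>coeff_part K p. x - \<kappa>' \<in> E"
proof (cases "p < 0")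
  case True
  then show ?thesis
    using hom_part_neg[OF x] coeff_part_0[OF K] by (intro bexI[of _ 0]) auto
next
  case False
  then obtain q where p: "p = int q" by (metis int_nat_eq not_less)
  have "coord S x \<in> K" for S
  proof -
    have "g * coord S x = coord S \<kappa>"
      using coord_E[OF \<kappa>(2), of S] by simp
    then show ?thesis
      using nzd coord_coeff_part[OF K \<kappa>(1)] by metis
  qed
  then have "(\<Sum>S\<in>subsets q. sc (coord S x) * basis_word S) \<in> coeff_part K p"
    unfolding p by (intro coeff_part_sum[OF K] coeff_part_sc_mem[OF K] basis_word_hom_part)
  then show ?thesis
    using hom_part_expands[of x q] x unfolding p expands_def by blast
qed

end

subsection \<open>Division by decomposable elements\<close>

text \<open>The recursion absorbs the first element into the base ideal, which matches an induction
  on the list with varying K.\<close>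

primrec regular_mod :: "'a::comm_ring_1 set \<Rightarrow> 'a list \<Rightarrow> bool" where
  "regular_mod K [] \<longleftrightarrow> True"
| "regular_mod K (x # xs) \<longleftrightarrow> (\<forall>a. x * a \<in> K \<longrightarrow> a \<in> K) \<and> regular_mod (adjoin K x) xs"

locale wedge_setting = free_module +
  fixes w :: "nat \<Rightarrow> 'b" and r :: nat
begin

definition top_word :: "('a, 'b) free_alg" where
  "top_word = wd (map w [1..<Suc r])"

text \<open>Defined from the contractions of \<open>top_word\<close>, independently of any given
  coefficient family; the main proof identifies it with I.\<close>

definition coord_ideal :: "'a set" where
  "coord_ideal = Idl\<^bsub>ring_of_type_algebra\<^esub> ((\<lambda>S. coord S top_word) ` subsets r)"

abbreviation "\<Omega> \<equiv> w ` {1..r}"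

lemma top_word_prefix: "top_word \<in> prefix_part \<Omega> r (int r)"
  by (auto simp: top_word_def intro!: prefix_part_single)

lemma length_dual_list: "S \<in> subsets r \<Longrightarrow> length (map dual (sorted_list_of_set S)) = r"
  by auto

lemma fold_contr_top_word:
  assumes "S \<in> subsets r"
  shows "fold contr (map dual (sorted_list_of_set S)) top_word = sc (coord S top_word)"
proof -
  have "fold contr (map dual (sorted_list_of_set S)) top_word \<in> hom_part 0"
    using fold_contr_prefix_part[OF top_word_prefix, of "map dual (sorted_list_of_set S)"]
      length_dual_list[OF assms] by (simp only: prefix_part_0_eq diff_self_eq_0 diff_self)
  then show ?thesis
    unfolding coord_def by (rule hom_part_0_eq_sc)
qed

text \<open>The divisibility claims below are additive and linear in g, so checking them on the
  coefficients settles the whole ideal, with no power of it involved.\<close>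

lemma coord_ideal_induct [consumes 1, case_names coord zero add mult]:
  assumes "g \<in> coord_ideal" "\<And>S. S \<in> subsets r \<Longrightarrow> P (coord S top_word)" "P 0"
    "\<And>a b. P a \<Longrightarrow> P b \<Longrightarrow> P (a + b)" "\<And>a b. P b \<Longrightarrow> P (a * b)"
  shows "P g"
proof -
  have "ideal {a. P a} ring_of_type_algebra"
    unfolding ideal_ring_of_type_algebra_iff using assms(3-) by (auto simp: mult.commute)
  then have "coord_ideal \<subseteq> {a. P a}"
    unfolding coord_ideal_def by (rule type_Idl_minimal) (use assms(2) in auto)
  with assms(1) show ?thesis by blast
qed

lemma annihilated_multiple:
  assumes "g \<in> coord_ideal" and y: "y \<in> hom_part k" "\<And>i. i \<in> {1..r} \<Longrightarrow> wd [w i] * y \<in> E"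
  shows "\<exists>\<alpha>\<in>hom_part (k - int r). sc g * y - top_word * \<alpha> \<in> E"
  using assms(1)
proof (induction g rule: coord_ideal_induct)
  case (coord S)
  let ?F = "map dual (sorted_list_of_set S)"
  have F: "length ?F = r" using coord by (rule length_dual_list)
  have "\<exists>s. top_word * foldr contr ?F y - sc s * (fold contr ?F top_word * y) \<in> E \<and> s \<in> {1, -1}"
    by (rule E_mult_foldr_contr[OF _ _ top_word_prefix]) (use y(2) F lin_form_dual in auto)
  then obtain s where s: "s \<in> {1, -1}"
    and "top_word * foldr contr ?F y - sc s * (fold contr ?F top_word * y) \<in> E"
    by blast
  \<comment> \<open>Multiplying by -s isolates the multiple of y, since s * s = 1.\<close>
  then have "sc (- s) * (top_word * foldr contr ?F y - sc s * (sc (coord S top_word) * y)) \<in> E"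
    unfolding fold_contr_top_word[OF coord] by (intro E_lmult)
  moreover have "sc (- s) * (top_word * z - sc s * x) = x - top_word * (sc s * z)" for x z :: "('a, 'b) free_alg"
    using s by (auto simp: mult_sc_left[of top_word] right_diff_distrib sc_mult_sc sc_1 single_uminus)
  ultimately have "sc (coord S top_word) * y - top_word * (sc s * foldr contr ?F y) \<in> E"
    by simp
  moreover have "sc s * foldr contr ?F y \<in> hom_part (k - int r)"
    using foldr_contr_hom_part[OF y(1), of ?F] F by (intro hom_part_sc) simp
  ultimately show ?case by blast
next
  case zero
  show ?case by (intro bexI[of _ 0]) auto
next
  case (add a b)
  then obtain \<alpha> \<beta> where ab: "\<alpha> \<in> hom_part (k - int r)" "sc a * y - top_word * \<alpha> \<in> E"
    "\<beta> \<in> hom_part (k - int r)" "sc b * y - top_word * \<beta> \<in> E" by blast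
  then show ?case
    using E_add[OF ab(2,4)]
    by (intro bexI[of _ "\<alpha> + \<beta>"]) (auto simp: single_add algebra_simps intro: hom_part_add)
next
  case (mult a b)
  then obtain \<alpha> where "\<alpha> \<in> hom_part (k - int r)" "sc b * y - top_word * \<alpha> \<in> E" by blast
  moreover from E_lmult[OF this(2), of "sc a"] have "sc (a * b) * y - top_word * (sc a * \<alpha>) \<in> E"
    by (simp add: mult_sc_left[of top_word] right_diff_distrib sc_mult_sc)
  ultimately show ?case
    by (blast intro: hom_part_sc)
qed

text \<open>Contracting \<open>top_word * y\<close> by all r forms gives the coefficient times y, up
  to terms that keep a letter from \<Omega> in front; the correction \<kappa> keeps its coefficients
  in K.\<close>

lemma killed_multiple:
  assumes "g \<in> coord_ideal" and K: "ideal K ring_of_type_algebra"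
    and y: "y \<in> hom_part p" and \<kappa>: "\<kappa> \<in> coeff_part K (int r + p)" "top_word * y - \<kappa> \<in> E"
  shows "\<exists>\<delta>\<in>prefix_part \<Omega> 1 p. \<exists>\<kappa>'\<in>coeff_part K p. sc g * y - \<delta> - \<kappa>' \<in> E"
  using assms(1)
proof (induction g rule: coord_ideal_induct)
  case (coord S)
  let ?F = "map dual (sorted_list_of_set S)"
  have F: "length ?F = r" using coord by (rule length_dual_list)
  define \<delta> where "\<delta> = fold contr ?F (top_word * y) - sc (coord S top_word) * y"
  have "\<delta> \<in> prefix_part \<Omega> 1 p"
    using fold_contr_mult_prefix_part[OF top_word_prefix y F]
    by (simp only: \<delta>_def fold_contr_top_word[OF coord])
  then have "0 - \<delta> \<in> prefix_part \<Omega> 1 p"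
    by (intro prefix_part_diff) auto
  moreover have "fold contr ?F \<kappa> \<in> coeff_part K p"
    using fold_contr_coeff_part[OF K \<kappa>(1), of ?F] F by simp
  moreover have "fold contr ?F (top_word * y - \<kappa>) \<in> E"
    by (intro E_fold_contr \<kappa>(2)) (auto simp: lin_form_dual)
  then have "sc (coord S top_word) * y - (0 - \<delta>) - fold contr ?F \<kappa> \<in> E"
    by (simp add: \<delta>_def)
  ultimately show ?case by blast
next
  case zero
  show ?case using coeff_part_0[OF K] by (intro bexI[of _ 0]) auto
next
  case (add a b)
  then obtain \<delta> \<kappa> \<delta>' \<kappa>' where ab: "\<delta> \<in> prefix_part \<Omega> 1 p" "\<kappa> \<in> coeff_part K p" "sc a * y - \<delta> - \<kappa> \<in> E"
    "\<delta>' \<in> prefix_part \<Omega> 1 p" "\<kappa>' \<in> coeff_part K p" "sc b * y - \<delta>' - \<kappa>' \<in> E" by blast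
  then show ?case
    using E_add[OF ab(3,6)]
    by (intro bexI[of _ "\<delta> + \<delta>'"] bexI[of _ "\<kappa> + \<kappa>'"])
      (auto simp: single_add distrib_right algebra_simps intro: prefix_part_add coeff_part_add[OF K])
next
  case (mult a b)
  then obtain \<delta> \<kappa> where *: "\<delta> \<in> prefix_part \<Omega> 1 p" "\<kappa> \<in> coeff_part K p" "sc b * y - \<delta> - \<kappa> \<in> E" by blast
  from E_lmult[OF *(3), of "sc a"] have "sc (a * b) * y - sc a * \<delta> - sc a * \<kappa> \<in> E"
    by (simp add: right_diff_distrib sc_mult_sc)
  with *(1,2) show ?case
    by (blast intro: prefix_part_sc coeff_part_sc[OF K])
qed

section \<open>Products of subfamilies of the vectors, and cofactors with respect to them\<close>

definition sub_word :: "nat set \<Rightarrow> ('a, 'b) free_alg" where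
  "sub_word J = wd (map w (sorted_list_of_set J))"

abbreviation "index_sets q \<equiv> {J. J \<subseteq> {1..r} \<and> card J = q}"

lemma finite_index_sets: "finite (index_sets q)"
  by (rule finite_subset[of _ "Pow {1..r}"]) auto

lemma set_sub_word: "J \<in> index_sets q \<Longrightarrow> set (map w (sorted_list_of_set J)) \<subseteq> \<Omega>"
  using finite_subset[of J "{1..r}"] by auto

lemma sub_word_mult_hom_part:
  assumes "J \<in> index_sets q" "x \<in> hom_part p"
  shows "sub_word J * x \<in> prefix_part \<Omega> q (int q + p)"
proof -
  have "sub_word J \<in> prefix_part \<Omega> q (int q)"
    unfolding sub_word_def using assms(1) set_sub_word[OF assms(1)]
    by (intro prefix_part_single) auto
  then show ?thesis
    using assms(2) by (rule prefix_part_mult_hom_part)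
qed

lemma sub_word_mult_prefix_part:
  assumes "J \<in> index_sets q" "x \<in> prefix_part \<Omega> q' p"
  shows "sub_word J * x \<in> prefix_part \<Omega> (q + q') (int q + p)"
  using word_mult_prefix_part[OF assms(2) set_sub_word[OF assms(1)], of 1] assms(1)
  by (simp add: sub_word_def)

lemma sub_word_mult_coeff_part:
  assumes "ideal K ring_of_type_algebra" "J \<in> index_sets q" "x \<in> coeff_part K p"
  shows "sub_word J * x \<in> coeff_part K (int q + p)"
  using word_mult_coeff_part[OF assms(1,3), of "map w (sorted_list_of_set J)"] assms(2)
  by (simp add: sub_word_def)

lemma sub_word_compl:
  assumes "J \<in> index_sets q"
  shows "\<exists>s. top_word - sc s * (sub_word ({1..r} - J) * sub_word J) \<in> E"
proof -
  have J: "finite J" "J \<subseteq> {1..r}" using assms finite_subset[of J "{1..r}"] by auto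
  let ?l = "sorted_list_of_set ({1..r} - J) @ sorted_list_of_set J"
  obtain s where s: "s \<in> {1, -1}" "wd (map w ?l) - sc s * wd (map w (sort ?l)) \<in> E"
    using E_word_sort by blast
  have "distinct ?l" "set ?l = {1..r}"
    using J by auto
  then have "sort ?l = sorted_list_of_set {1..r}"
    by (metis sorted_list_of_set_sort_remdups distinct_remdups_id)
  then have l: "sort ?l = [1..<Suc r]"
    by (simp del: upt_Suc add: atLeastLessThanSuc_atLeastAtMost flip: sorted_list_of_set_range)
  define x where "x = sub_word ({1..r} - J) * sub_word J"
  have "wd (map w ?l) = x"
    by (simp add: x_def sub_word_def)
  with s(2) have "- sc s * (x - sc s * top_word) \<in> E"
    unfolding l top_word_def by (intro E_lmult) simp
  moreover have "- sc s * (x - sc s * top_word) = top_word - sc s * x"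
    using s(1) by (auto simp: right_diff_distrib sc_mult_sc sc_1 single_uminus)
  ultimately show ?thesis
    unfolding x_def by auto
qed

text \<open>Distinct sets of equal size are not nested, so J' meets the complement of J and a letter
  repeats.\<close>

lemma sub_word_mult_disjoint:
  assumes "J \<in> index_sets q" "J' \<in> index_sets q" "J \<noteq> J'"
  shows "sub_word ({1..r} - J) * sub_word J' \<in> E"
proof -
  have f: "finite J" "finite J'" using assms finite_subset[of _ "{1..r}"] by auto
  have "\<not> J' \<subseteq> J"
    using assms f card_subset_eq by blast
  then obtain j where "j \<in> J'" "j \<notin> J" by blast
  then have "w j \<in> set (map w (sorted_list_of_set ({1..r} - J))) \<inter> set (map w (sorted_list_of_set J'))"
    using assms f by auto
  then have "wd (map w (sorted_list_of_set ({1..r} - J)) @ map w (sorted_list_of_set J')) \<in> E"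
    by (intro E_word_not_distinct) (metis distinct_append empty_iff)
  then show ?thesis by (simp add: sub_word_def)
qed

lemma prefix_part_decompose:
  assumes "d \<in> prefix_part \<Omega> q p"
  shows "\<exists>\<gamma>. (\<forall>J. \<gamma> J \<in> hom_part (p - int q)) \<and> d - (\<Sum>J\<in>index_sets q. sub_word J * \<gamma> J) \<in> E"
  using assms
proof (induction d rule: prefix_part_induct)
  case zero
  show ?case by (intro exI[of _ "\<lambda>_. 0"]) auto
next
  case (add x y)
  then obtain \<gamma> \<delta> where g: "\<forall>J. \<gamma> J \<in> hom_part (p - int q)" "x - (\<Sum>J\<in>index_sets q. sub_word J * \<gamma> J) \<in> E"
    and d: "\<forall>J. \<delta> J \<in> hom_part (p - int q)" "y - (\<Sum>J\<in>index_sets q. sub_word J * \<delta> J) \<in> E" by blast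
  have "x + y - (\<Sum>J\<in>index_sets q. sub_word J * (\<gamma> J + \<delta> J)) \<in> E"
    using E_add[OF g(2) d(2)] by (simp add: algebra_simps sum.distrib)
  then show ?case
    using g(1) d(1) by (intro exI[of _ "\<lambda>J. \<gamma> J + \<delta> J"]) (auto intro: hom_part_add)
next
  case (single v a)
  have sp: "Poly_Mapping.single v a = wd (take q v) * Poly_Mapping.single (drop q v) a"
    by simp
  have rest: "Poly_Mapping.single (drop q v) a \<in> hom_part (p - int q)"
    using single by (intro hom_part_single) (simp add: of_nat_diff)
  from single have "take q v \<in> lists \<Omega>"
    by (simp add: lists_eq_set)
  \<comment> \<open>Letters are lifted to indices, because \<open>w\<close> need not be injective
    and only indices can be sorted.\<close>
  then obtain l where l: "take q v = map w l" "set l \<subseteq> {1..r}"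
    unfolding lists_image by (auto simp: lists_eq_set simp del: One_nat_def)
  have len: "length l = q" using l(1) single(2) by (metis length_map length_take min.absorb2)
  show ?case
  proof (cases "distinct l")
    case False
    then have "wd (take q v) \<in> E"
      unfolding l(1) by (intro E_word_not_distinct) (simp add: distinct_map)
    then have "Poly_Mapping.single v a \<in> E"
      unfolding sp by (rule E_rmult)
    then show ?thesis by (intro exI[of _ "\<lambda>_. 0"]) auto
  next
    case True
    define z where "z = Poly_Mapping.single (drop q v) a"
    obtain s where s: "wd (map w l) - sc s * wd (map w (sort l)) \<in> E"
      using E_word_sort by blast
    have "sort l = sorted_list_of_set (set l)"
      using True by (metis sorted_list_of_set_sort_remdups distinct_remdups_id)
    with s have "wd (map w l) - sc s * sub_word (set l) \<in> E"
      by (simp add: sub_word_def)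
    from E_rmult[OF this, of z]
    have "Poly_Mapping.single v a - sub_word (set l) * (sc s * z) \<in> E"
      unfolding sp l(1) z_def[symmetric]
      by (simp add: left_diff_distrib mult.assoc mult_sc_left[of "sub_word (set l)"])
    moreover have "(\<Sum>J\<in>index_sets q. sub_word J * (if J = set l then sc s * z else 0))
       = (\<Sum>J\<in>index_sets q. if J = set l then sub_word (set l) * (sc s * z) else 0)"
      by (intro sum.cong) auto
    then have "(\<Sum>J\<in>index_sets q. sub_word J * (if J = set l then sc s * z else 0))
        = sub_word (set l) * (sc s * z)"
      using True len l(2) by (simp add: finite_index_sets distinct_card)
    ultimately show ?thesis
      using rest[folded z_def] by (intro exI[of _ "\<lambda>J. if J = set l then sc s * z else 0"]) (auto simp del: single_mult_single intro!: hom_part_sc)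
  qed
qed

text \<open>Multiplication by the word of the complementary indices isolates a single \<open>\<gamma> J\<close>, since all other
  products repeat a letter.\<close>

lemma sub_word_factor_killed:
  assumes K: "ideal K ring_of_type_algebra" and J: "J \<in> index_sets q"
    and \<kappa>: "\<kappa> \<in> coeff_part K p" "(\<Sum>J\<in>index_sets q. sub_word J * \<gamma> J) - \<kappa> \<in> E"
  shows "\<exists>\<kappa>'\<in>coeff_part K (int r + (p - int q)). top_word * \<gamma> J - \<kappa>' \<in> E"
proof -
  define C where "C = {1..r} - J"
  have q: "q \<le> r" and C: "C \<in> index_sets (r - q)"
    using J card_mono[of "{1..r}" J] card_Diff_subset[of J "{1..r}"] finite_subset[of J "{1..r}"]
    by (auto simp: C_def)
  obtain s where s: "top_word - sc s * (sub_word C * sub_word J) \<in> E"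
    using sub_word_compl[OF J] unfolding C_def by blast
  have rest: "(\<Sum>J'\<in>index_sets q - {J}. sub_word C * sub_word J' * \<gamma> J') \<in> E"
    unfolding C_def using J by (intro type_ideal_sum[OF ideal_E] E_rmult sub_word_mult_disjoint[OF J]) auto
  have split: "sub_word C * (\<Sum>J\<in>index_sets q. sub_word J * \<gamma> J)
      = sub_word C * sub_word J * \<gamma> J + (\<Sum>J'\<in>index_sets q - {J}. sub_word C * sub_word J' * \<gamma> J')"
    unfolding sum.remove[OF finite_index_sets J] by (simp only: sum_distrib_left distrib_left mult.assoc)
  have "sub_word C * (\<Sum>J\<in>index_sets q. sub_word J * \<gamma> J) - sub_word C * \<kappa> \<in> E"
    using \<kappa>(2) by (rule E_lmult_cong)
  from E_diff[OF this rest] have "sub_word C * sub_word J * \<gamma> J - sub_word C * \<kappa> \<in> E"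
    unfolding split
    by (simp only: cancel_ab_semigroup_add_class.diff_right_commute[of _ "sub_word C * \<kappa>"] add_diff_cancel_right')
  from E_lmult_cong[OF this, of "sc s"]
  have "sc s * (sub_word C * sub_word J) * \<gamma> J - sc s * (sub_word C * \<kappa>) \<in> E"
    by (simp add: mult.assoc)
  with E_rmult_cong[OF s, of "\<gamma> J"] have "top_word * \<gamma> J - sc s * (sub_word C * \<kappa>) \<in> E"
    by (rule E_trans)
  moreover have "sc s * (sub_word C * \<kappa>) \<in> coeff_part K (int r + (p - int q))"
    using coeff_part_sc[OF K sub_word_mult_coeff_part[OF K C \<kappa>(1)]] q
    by (simp add: of_nat_diff algebra_simps)
  ultimately show ?thesis by blast
qed

text \<open>Each step trades \<open>q\<close> leading letters from \<open>\<Omega>\<close> for \<open>q + 1\<close> of them, at the cost of a multiple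
  of \<open>x\<close>; once \<open>q > p\<close>, nothing is left.\<close>

lemma prefix_part_mod_descent:
  assumes K: "ideal K ring_of_type_algebra"
    and IH: "\<And>p' y \<kappa>. p' < p \<Longrightarrow> y \<in> hom_part p' \<Longrightarrow> \<kappa> \<in> coeff_part (adjoin K x) (int r + p') \<Longrightarrow>
      top_word * y - \<kappa> \<in> E \<Longrightarrow>
      \<exists>\<delta>\<in>prefix_part \<Omega> 1 p'. \<exists>\<kappa>'\<in>coeff_part (adjoin K x) p'. y - \<delta> - \<kappa>' \<in> E"
    and "1 \<le> q" "d \<in> prefix_part \<Omega> q p" "\<kappa> \<in> coeff_part (adjoin K x) p" "d - \<kappa> \<in> E"
  shows "\<exists>\<delta>\<in>prefix_part \<Omega> 1 p. \<exists>\<kappa>'\<in>coeff_part K p. d - sc x * \<delta> - \<kappa>' \<in> E"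
  using assms(3-)
proof (induction "nat (p + 1) - q" arbitrary: q d \<kappa> rule: less_induct)
  case less
  note K' = ideal_adjoin[OF K, of x]
  show ?case
  proof (cases "p < int q")
    case True
    then have "d = 0" using less.prems(2) prefix_part_short by blast
    then show ?thesis
      using coeff_part_0[OF K] by (intro bexI[of _ 0]) auto
  next
    case False
    obtain \<gamma> where \<gamma>: "\<And>J. \<gamma> J \<in> hom_part (p - int q)"
      and d: "d - (\<Sum>J\<in>index_sets q. sub_word J * \<gamma> J) \<in> E"
      using prefix_part_decompose[OF less.prems(2)] by blast
    have "(\<Sum>J\<in>index_sets q. sub_word J * \<gamma> J) - \<kappa> \<in> E"
      using E_diff[OF less.prems(4) d] by simp
    note factor = sub_word_factor_killed[OF K' _ less.prems(3) this]
    \<comment> \<open>The cofactor \<gamma> J has degree p - q < p, so the hypothesis for K + (x)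
      applies; its error term is then split into a part over K and a multiple of x.\<close>
    have "\<exists>\<delta>\<in>prefix_part \<Omega> 1 (p - int q). \<exists>\<kappa>0\<in>coeff_part K (p - int q). \<exists>\<rho>\<in>hom_part (p - int q).
        \<gamma> J - \<delta> - \<kappa>0 - sc x * \<rho> \<in> E" if J: "J \<in> index_sets q" for J
    proof -
      obtain \<kappa>' where "\<kappa>' \<in> coeff_part (adjoin K x) (int r + (p - int q))" "top_word * \<gamma> J - \<kappa>' \<in> E"
        using factor[OF J] by blast
      then obtain \<delta> \<kappa>'' where *: "\<delta> \<in> prefix_part \<Omega> 1 (p - int q)" "\<kappa>'' \<in> coeff_part (adjoin K x) (p - int q)"
        "\<gamma> J - \<delta> - \<kappa>'' \<in> E"
        using IH[of "p - int q" "\<gamma> J" \<kappa>'] \<gamma> less.prems(1) by auto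
      obtain \<kappa>0 \<rho> where **: "\<kappa>0 \<in> coeff_part K (p - int q)" "\<rho> \<in> hom_part (p - int q)" "\<kappa>'' = \<kappa>0 + sc x * \<rho>"
        using coeff_part_adjoin[OF K *(2)] .
      have "\<gamma> J - \<delta> - \<kappa>0 - sc x * \<rho> \<in> E"
        using *(3) by (simp add: **(3) algebra_simps)
      with *(1) **(1,2) show ?thesis by blast
    qed
    then have "\<forall>J\<in>index_sets q. \<exists>\<delta> \<kappa>0 \<rho>. \<delta> \<in> prefix_part \<Omega> 1 (p - int q) \<and> \<kappa>0 \<in> coeff_part K (p - int q) \<and>
        \<rho> \<in> hom_part (p - int q) \<and> \<gamma> J - \<delta> - \<kappa>0 - sc x * \<rho> \<in> E"
      by blast
    then obtain \<delta> \<kappa>0 \<rho> where choice: "\<And>J. J \<in> index_sets q \<Longrightarrow>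
        \<delta> J \<in> prefix_part \<Omega> 1 (p - int q) \<and> \<kappa>0 J \<in> coeff_part K (p - int q) \<and>
        \<rho> J \<in> hom_part (p - int q) \<and> \<gamma> J - \<delta> J - \<kappa>0 J - sc x * \<rho> J \<in> E"
      unfolding bchoice_iff by blast
    define \<delta>' where "\<delta>' = (\<Sum>J\<in>index_sets q. sub_word J * \<delta> J)"
    define \<kappa>' where "\<kappa>' = (\<Sum>J\<in>index_sets q. sub_word J * \<kappa>0 J)"
    define \<rho>' where "\<rho>' = (\<Sum>J\<in>index_sets q. sub_word J * \<rho> J)"
    have \<delta>': "\<delta>' \<in> prefix_part \<Omega> (q + 1) p"
      unfolding \<delta>'_def
    proof (rule prefix_part_sum)
      fix J assume J: "J \<in> index_sets q"
      show "sub_word J * \<delta> J \<in> prefix_part \<Omega> (q + 1) p"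
        using sub_word_mult_prefix_part[OF J, of "\<delta> J" 1 "p - int q"] choice[OF J] by simp
    qed
    have \<kappa>': "\<kappa>' \<in> coeff_part K p"
      unfolding \<kappa>'_def
    proof (rule coeff_part_sum[OF K])
      fix J assume J: "J \<in> index_sets q"
      show "sub_word J * \<kappa>0 J \<in> coeff_part K p"
        using sub_word_mult_coeff_part[OF K J, of "\<kappa>0 J" "p - int q"] choice[OF J] by simp
    qed
    have \<rho>': "\<rho>' \<in> prefix_part \<Omega> q p"
      unfolding \<rho>'_def
    proof (rule prefix_part_sum)
      fix J assume J: "J \<in> index_sets q"
      show "sub_word J * \<rho> J \<in> prefix_part \<Omega> q p"
        using sub_word_mult_hom_part[OF J, of "\<rho> J" "p - int q"] choice[OF J] by simp
    qed
    have "(\<Sum>J\<in>index_sets q. sub_word J * (\<gamma> J - \<delta> J - \<kappa>0 J - sc x * \<rho> J)) \<in> E"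
      using choice by (intro type_ideal_sum[OF ideal_E] E_lmult) blast
    also have "(\<Sum>J\<in>index_sets q. sub_word J * (\<gamma> J - \<delta> J - \<kappa>0 J - sc x * \<rho> J))
        = (\<Sum>J\<in>index_sets q. sub_word J * \<gamma> J) - \<delta>' - \<kappa>' - sc x * \<rho>'"
      unfolding \<delta>'_def \<kappa>'_def \<rho>'_def
      by (simp add: right_diff_distrib sum_subtractf sum_distrib_left mult_sc_left[of "sub_word _"])
    finally have d': "d - \<delta>' - \<kappa>' - sc x * \<rho>' \<in> E"
      using E_add[OF d] by (fastforce simp: algebra_simps)
    have "\<rho>' \<in> hom_part p" using \<rho>' prefix_part_subset_hom_part by blast
    \<comment> \<open>This is the error term for \<delta>': the remainder with q + 1 leading letters
      again vanishes modulo K + (x), so the descent continues.\<close>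
    then have "\<kappa> - \<kappa>' - sc x * \<rho>' \<in> coeff_part (adjoin K x) p"
      using \<kappa>' less.prems(3) mem_adjoin[OF K, of x] subset_adjoin[OF K, of x]
      by (intro coeff_part_diff[OF K'] coeff_part_sc_mem[OF K']) (auto simp: coeff_part_def)
    moreover have "\<delta>' - (\<kappa> - \<kappa>' - sc x * \<rho>') \<in> E"
      using E_diff[OF less.prems(4) d'] by (simp add: algebra_simps)
    moreover have "nat (p + 1) - (q + 1) < nat (p + 1) - q"
      using False by simp
    ultimately obtain \<delta>'' \<kappa>'' where ih: "\<delta>'' \<in> prefix_part \<Omega> 1 p" "\<kappa>'' \<in> coeff_part K p"
      "\<delta>' - sc x * \<delta>'' - \<kappa>'' \<in> E"
      using less.hyps[OF _ _ \<delta>'] by (metis le_add2)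
    have "d - sc x * (\<rho>' + \<delta>'') - (\<kappa>' + \<kappa>'') \<in> E"
      using E_add[OF d' ih(3)] by (simp add: algebra_simps)
    moreover have "\<rho>' + \<delta>'' \<in> prefix_part \<Omega> 1 p"
      using \<rho>' ih(1) less.prems(1) prefix_part_mono[of 1 q \<Omega> p] by (blast intro: prefix_part_add)
    moreover have "\<kappa>' + \<kappa>'' \<in> coeff_part K p"
      using \<kappa>' ih(2) by (rule coeff_part_add[OF K])
    ultimately show ?thesis by blast
  qed
qed

text \<open>Write x y = d + \<kappa>1 by contraction, replace d by x \<delta> through the descent,
  and cancel x modulo K. The descent calls the induction hypothesis in degrees below p only, which
  pays for the element x lost from the list. For the empty list the degree is negative.\<close>

lemma killed_mod_regular:
  assumes "ideal K ring_of_type_algebra" "regular_mod K xs" "set xs \<subseteq> coord_ideal" "p < int (length xs)"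
    and "y \<in> hom_part p" "\<kappa> \<in> coeff_part K (int r + p)" "top_word * y - \<kappa> \<in> E"
  shows "\<exists>\<delta>\<in>prefix_part \<Omega> 1 p. \<exists>\<kappa>'\<in>coeff_part K p. y - \<delta> - \<kappa>' \<in> E"
  using assms
proof (induction xs arbitrary: K p y \<kappa>)
  case Nil
  then have "y = 0" using hom_part_neg by auto
  then show ?case
    using coeff_part_0[OF Nil.prems(1)] by (intro bexI[of _ 0]) auto
next
  case (Cons x xs)
  note K = Cons.prems(1)
  note K' = ideal_adjoin[OF K, of x]
  obtain d \<kappa>1 where d: "d \<in> prefix_part \<Omega> 1 p" "\<kappa>1 \<in> coeff_part K p" "sc x * y - d - \<kappa>1 \<in> E"
    using killed_multiple[OF _ K Cons.prems(5-7), of x] Cons.prems(3) by auto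
  \<comment> \<open>This element is congruent to d and has coefficients in K + (x), which is the
    hypothesis that starts the descent.\<close>
  have "sc x * y - \<kappa>1 \<in> coeff_part (adjoin K x) p"
    using d(2) Cons.prems(5) mem_adjoin[OF K, of x] subset_adjoin[OF K, of x]
    by (intro coeff_part_diff[OF K'] coeff_part_sc_mem[OF K']) (auto simp: coeff_part_def)
  moreover have "d - (sc x * y - \<kappa>1) \<in> E"
    using E_uminus[OF d(3)] by (simp add: algebra_simps)
  moreover have "\<exists>\<delta>\<in>prefix_part \<Omega> 1 p'. \<exists>\<kappa>'\<in>coeff_part (adjoin K x) p'. y - \<delta> - \<kappa>' \<in> E"
    if "p' < p" "y \<in> hom_part p'" "\<kappa> \<in> coeff_part (adjoin K x) (int r + p')" "top_word * y - \<kappa> \<in> E"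
    for p' y \<kappa>
    using Cons.prems that by (intro Cons.IH[OF K']) auto
  ultimately obtain \<delta> \<kappa>2 where \<delta>: "\<delta> \<in> prefix_part \<Omega> 1 p" "\<kappa>2 \<in> coeff_part K p" "d - sc x * \<delta> - \<kappa>2 \<in> E"
    using prefix_part_mod_descent[OF K _ order_refl d(1)] by metis
  have "sc x * (y - \<delta>) - (\<kappa>1 + \<kappa>2) \<in> E"
    using E_add[OF d(3) \<delta>(3)] by (simp add: algebra_simps)
  moreover have "y - \<delta> \<in> hom_part p"
    using \<delta>(1) Cons.prems(5) prefix_part_subset_hom_part by (blast intro: hom_part_diff)
  moreover have "\<kappa>1 + \<kappa>2 \<in> coeff_part K p"
    using d(2) \<delta>(2) by (rule coeff_part_add[OF K])
  moreover have "a \<in> K" if "x * a \<in> K" for a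
    using Cons.prems(2) that by simp
  ultimately have "\<exists>\<kappa>'\<in>coeff_part K p. y - \<delta> - \<kappa>' \<in> E"
    using nonzerodivisor_coeff_part[OF K] by blast
  with \<delta>(1) show ?case by blast
qed

text \<open>The first letter of each word of \<delta> already occurs in
  \<open>top_word\<close>.\<close>

lemma top_word_mult_prefix_part:
  assumes "\<delta> \<in> prefix_part \<Omega> 1 p"
  shows "top_word * \<delta> \<in> E"
  using assms
proof (induction \<delta> rule: prefix_part_induct)
  case (single v a)
  then obtain b v' where v: "v = b # v'" "b \<in> \<Omega>"
    by (cases v) auto
  have "wd (map w [1..<Suc r] @ [b]) \<in> E"
    using v(2) by (intro E_word_not_distinct) auto
  from E_rmult[OF this, of "Poly_Mapping.single v' a"] show ?case
    by (simp add: top_word_def v del: upt_Suc)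
qed (auto simp: distrib_left intro: E_add)

lemma annihilated_divisible:
  assumes "regular_mod {0} xs" "set xs \<subseteq> coord_ideal" "xs \<noteq> []" "k < int (length xs) + int r - 1"
    and y: "y \<in> hom_part k" "\<And>i. i \<in> {1..r} \<Longrightarrow> wd [w i] * y \<in> E"
  shows "\<exists>\<alpha>\<in>hom_part (k - int r). y - top_word * \<alpha> \<in> E"
proof -
  obtain x xs' where xs: "xs = x # xs'" using assms(3) by (cases xs) auto
  note K' = ideal_adjoin[OF ideal_0, of x]
  obtain \<alpha> where \<alpha>: "\<alpha> \<in> hom_part (k - int r)" "sc x * y - top_word * \<alpha> \<in> E"
    using annihilated_multiple[OF _ y, of x] assms(2) xs by auto
  have "sc x * y \<in> coeff_part (adjoin {0} x) (int r + (k - int r))"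
    using coeff_part_sc_mem[OF K' y(1) mem_adjoin[OF ideal_0]] by simp
  moreover have "top_word * \<alpha> - sc x * y \<in> E"
    using E_uminus[OF \<alpha>(2)] by simp
  ultimately have "\<exists>\<delta>\<in>prefix_part \<Omega> 1 (k - int r). \<exists>\<kappa>\<in>coeff_part (adjoin {0} x) (k - int r). \<alpha> - \<delta> - \<kappa> \<in> E"
    using assms(1,2,4) xs by (intro killed_mod_regular[OF K' _ _ _ \<alpha>(1), of xs']) auto
  then obtain \<delta> \<kappa> where \<delta>: "\<delta> \<in> prefix_part \<Omega> 1 (k - int r)" "\<kappa> \<in> coeff_part (adjoin {0} x) (k - int r)"
    "\<alpha> - \<delta> - \<kappa> \<in> E" by blast
  obtain \<kappa>0 \<gamma> where \<gamma>: "\<kappa>0 \<in> coeff_part {0} (k - int r)" "\<gamma> \<in> hom_part (k - int r)" "\<kappa> = \<kappa>0 + sc x * \<gamma>"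
    using coeff_part_adjoin[OF ideal_0 \<delta>(2)] .
  have "\<alpha> - \<delta> - sc x * \<gamma> \<in> E"
    using \<delta>(3) \<gamma>(3) coeff_part_zero_ideal[OF \<gamma>(1)] by simp
  \<comment> \<open>With u for \<open>top_word\<close>, the sum of x y - u \<alpha>, u (\<alpha> -
    \<delta> - x \<gamma>) and u \<delta> telescopes to x (y - u \<gamma>).\<close>
  from E_add[OF E_add[OF \<alpha>(2) E_lmult[OF this, of top_word]] top_word_mult_prefix_part[OF \<delta>(1)]]
  have "sc x * (y - top_word * \<gamma>) - 0 \<in> E"
    by (simp add: algebra_simps mult_sc_left[of top_word])
  moreover have "y - top_word * \<gamma> \<in> hom_part k"
    using y(1) prefix_part_mult_hom_part[OF top_word_prefix \<gamma>(2)] prefix_part_subset_hom_part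
    by (intro hom_part_diff) auto
  moreover have "a \<in> {0}" if "x * a \<in> {0}" for a
    using assms(1) xs that by simp
  ultimately obtain \<kappa>' where "\<kappa>' \<in> coeff_part {0} k" "y - top_word * \<gamma> - \<kappa>' \<in> E"
    using nonzerodivisor_coeff_part[OF ideal_0] coeff_part_0[OF ideal_0] by blast
  then have "y - top_word * \<gamma> \<in> E"
    using coeff_part_zero_ideal by force
  with \<gamma>(2) show ?thesis by blast
qed

end

subsection \<open>Depth and the quotient ring\<close>

lemma adjoin_Idl:
  "adjoin (Idl\<^bsub>ring_of_type_algebra\<^esub> S) x = Idl\<^bsub>ring_of_type_algebra\<^esub> (insert x S)"
  for x :: "'a::comm_ring_1"
proof
  note S = type_Idl_ideal[of S] and xS = type_Idl_ideal[of "insert x S"]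
  have "Idl\<^bsub>ring_of_type_algebra\<^esub> S \<subseteq> Idl\<^bsub>ring_of_type_algebra\<^esub> (insert x S)"
    using type_Idl_superset[of "insert x S"] by (intro type_Idl_minimal[OF xS]) auto
  then show "adjoin (Idl\<^bsub>ring_of_type_algebra\<^esub> S) x \<subseteq> Idl\<^bsub>ring_of_type_algebra\<^esub> (insert x S)"
    using type_Idl_superset[of "insert x S"]
    by (auto simp: adjoin_def intro!: type_ideal_add[OF xS] type_ideal_rmult[OF xS])
  show "Idl\<^bsub>ring_of_type_algebra\<^esub> (insert x S) \<subseteq> adjoin (Idl\<^bsub>ring_of_type_algebra\<^esub> S) x"
    using mem_adjoin[OF S, of x] subset_adjoin[OF S, of x] type_Idl_superset[of S]
    by (intro type_Idl_minimal ideal_adjoin[OF S]) auto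
qed

lemma Idl_empty: "Idl\<^bsub>ring_of_type_algebra\<^esub> {} = {0 :: 'a::comm_ring_1}"
proof -
  from type_Idl_minimal[OF ideal_0, of "{}"] type_ideal_0[OF type_Idl_ideal, of "{} :: 'a set"]
  show ?thesis by auto
qed

text \<open>The set S collects the elements already consumed; the induction step moves the head of
  the list into it.\<close>

lemma regular_mod_Idl:
  fixes xs :: "'a::comm_ring_1 list"
  assumes "\<forall>i < length xs. \<forall>y. xs ! i * y \<in> Idl\<^bsub>ring_of_type_algebra\<^esub> (S \<union> set (take i xs)) \<longrightarrow>
    y \<in> Idl\<^bsub>ring_of_type_algebra\<^esub> (S \<union> set (take i xs))"
  shows "regular_mod (Idl\<^bsub>ring_of_type_algebra\<^esub> S) xs"
  using assms
proof (induction xs arbitrary: S)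
  case (Cons x xs)
  have "\<forall>i < length xs. \<forall>y. xs ! i * y \<in> Idl\<^bsub>ring_of_type_algebra\<^esub> (insert x S \<union> set (take i xs)) \<longrightarrow>
    y \<in> Idl\<^bsub>ring_of_type_algebra\<^esub> (insert x S \<union> set (take i xs))"
  proof (intro allI impI)
    fix i y
    assume "i < length xs" "xs ! i * y \<in> Idl\<^bsub>ring_of_type_algebra\<^esub> (insert x S \<union> set (take i xs))"
    then show "y \<in> Idl\<^bsub>ring_of_type_algebra\<^esub> (insert x S \<union> set (take i xs))"
      using Cons.prems[rule_format, of "Suc i" y] by simp
  qed
  from Cons.IH[OF this] have "regular_mod (adjoin (Idl\<^bsub>ring_of_type_algebra\<^esub> S) x) xs"
    by (simp add: adjoin_Idl)
  then show ?case
    using Cons.prems by (auto dest: spec[of _ 0])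
qed simp

lemma regular_sequence_imp_regular_mod: "regular_sequence xs \<Longrightarrow> regular_mod {0} xs"
  using regular_mod_Idl[where S = "{}" and xs = xs] by (simp add: regular_sequence_def Idl_empty)

text \<open>Since the depth may be infinite, a longest sequence cannot be chosen. Instead, if every
  sequence is too short, the depth is finite and violates the strict bound.\<close>

lemma depth_witness:
  assumes "I \<noteq> UNIV" "depth I > 0"
    "ereal (real_of_int k) < ereal_of_enat (depth I) + ereal (real r) - 1"
  obtains xs where "regular_sequence xs" "set xs \<subseteq> I" "xs \<noteq> []" "k < int (length xs) + int r - 1"
proof (rule ccontr)
  assume contr: "\<not> thesis"
  note witness = that
  \<comment> \<open>The largest length that fails the wanted inequality; truncation at 0 covers the
    empty sequence.\<close>
  define N where "N = nat (k - int r + 1)"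
  have "enat (length xs) \<le> enat N" if "regular_sequence xs" "set xs \<subseteq> I" for xs
    using that contr witness[of xs] unfolding N_def by (cases "xs = []") force+
  then have "depth I \<le> enat N"
    using assms(1) unfolding depth_def by (auto intro!: Sup_least)
  then obtain d where d: "depth I = enat d" "d \<le> N"
    by (cases "depth I") auto
  with assms(2) have "0 < d" by (simp add: zero_enat_def)
  have "ereal (real_of_int k) < ereal (real d + real r - 1)"
    using assms(3) by (simp add: d(1) one_ereal_def)
  then have "real_of_int k < real d + real r - 1" by simp
  then have "k < int d + int r - 1" by linarith
  with d(2) \<open>0 < d\<close> show False unfolding N_def by linarith
qed

section \<open>Transfer from representatives to cosets in the exterior algebra\<close>

context
  fixes scale :: "'a::comm_ring_1 \<Rightarrow> 'b::ab_group_add \<Rightarrow> 'b"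
begin

lemma ext_class_eq_iff: "ext_class scale x = ext_class scale y \<longleftrightarrow> x - y \<in> ext_ideal scale"
proof -
  have m: "z \<in> ext_class scale x \<longleftrightarrow> z - x \<in> ext_ideal scale" for z x
    by (auto simp: ext_class_def a_r_coset_def r_coset_def) (metis diff_add_cancel)
  show ?thesis
  proof
    assume "ext_class scale x = ext_class scale y"
    then have "x \<in> ext_class scale y"
      using m[of x x] E_0 by simp
    then show "x - y \<in> ext_ideal scale" by (simp add: m)
  next
    assume xy: "x - y \<in> ext_ideal scale"
    have "z - x \<in> ext_ideal scale \<longleftrightarrow> z - y \<in> ext_ideal scale" for z
      by (rule E_mem_cong) (use E_uminus[OF xy] in simp)
    then show "ext_class scale x = ext_class scale y"
      by (auto simp: m)
  qed
qed

lemma ext_class_zero: "\<zero>\<^bsub>ext_algebra scale\<^esub> = ext_class scale 0"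
  by (auto simp: ext_algebra_def FactRing_def ext_class_def a_r_coset_def r_coset_def)

lemma ext_class_one: "\<one>\<^bsub>ext_algebra scale\<^esub> = ext_class scale 1"
  by (simp add: ext_algebra_def FactRing_def ext_class_def)

lemma ext_class_mult:
  "ext_class scale x \<otimes>\<^bsub>ext_algebra scale\<^esub> ext_class scale y = ext_class scale (x * y)"
  using ideal.rcoset_mult_add[OF ideal_E[of scale], of x y]
  by (simp add: ext_algebra_def FactRing_def ext_class_def)

lemma ext_class_add:
  "ext_class scale x \<oplus>\<^bsub>ext_algebra scale\<^esub> ext_class scale y = ext_class scale (x + y)"
  using ideal.a_rcos_sum[OF ideal_E[of scale], of x y]
  by (simp add: ext_algebra_def FactRing_def ext_class_def)

lemma ext_class_carrier: "ext_class scale x \<in> carrier (ext_algebra scale)"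
  by (auto simp: ext_algebra_def FactRing_def ext_class_def A_RCOSETS_def RCOSETS_def a_r_coset_def)

lemma ext_class_finsum:
  assumes "finite A"
  shows "(\<Oplus>\<^bsub>ext_algebra scale\<^esub> i\<in>A. ext_class scale (f i)) = ext_class scale (sum f A)"
proof -
  interpret ring "ext_algebra scale"
    unfolding ext_algebra_def by (rule ideal.quotient_is_ring[OF ideal_E])
  show ?thesis
    using assms
    by (induction A rule: finite_induct)
      (auto simp: ext_class_zero ext_class_carrier ext_class_add)
qed

lemma wedge_list_eq: "wedge_list scale vs = ext_class scale (wd vs)"
  unfolding wedge_list_def
  by (induction vs) (simp_all add: ext_class_one ext_class_mult ext_vec_def sc_1)

lemma ext_scale_class: "ext_scale scale a (ext_class scale x) = ext_class scale (sc a * x)"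
  by (simp add: ext_scale_def ext_class_mult)

lemma ext_power_eq: "ext_power scale k = ext_class scale ` hom_part k"
  by (simp add: ext_power_def hom_part_def)

end

theorem proposition2p2:
  fixes scale :: "'a::comm_ring_1 \<Rightarrow> 'b::ab_group_add \<Rightarrow> 'b"
    and n r :: nat and k :: int
    and e w :: "nat \<Rightarrow> 'b"
    and c :: "nat set \<Rightarrow> 'a"
    and I :: "'a set"
    and \<omega> :: "('b list \<Rightarrow>\<^sub>0 'a) set"
  assumes "noetherian_ring (ring_of_type_algebra :: 'a ring)"
    and "Modules.module scale"
    and "free_basis scale n e"
    and "r \<ge> 1"
    and "has_coeffs scale n e r (wedge_list scale (map w [1..<Suc r])) c"
    and "I = Idl\<^bsub>ring_of_type_algebra\<^esub> (c ` {S. S \<subseteq> {1..n} \<and> card S = r})"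
    and "\<omega> \<in> ext_power scale k"
    and "\<forall>i\<in>{1..r}. ext_vec scale (w i) \<otimes>\<^bsub>ext_algebra scale\<^esub> \<omega> = \<zero>\<^bsub>ext_algebra scale\<^esub>"
  shows "(\<exists>m::nat. \<forall>g \<in> I [^]\<^bsub>ideals_set (ring_of_type_algebra :: 'a ring)\<^esub> m.
            \<exists>\<alpha> \<in> ext_power scale (k - int r).
              ext_scale scale g \<omega> =
                wedge_list scale (map w [1..<Suc r]) \<otimes>\<^bsub>ext_algebra scale\<^esub> \<alpha>)
       \<and> (depth I > 0 \<and>
            ereal (real_of_int k) < ereal_of_enat (depth I) + ereal (real r) - 1 \<longrightarrow>
          (\<exists>\<alpha> \<in> ext_power scale (k - int r).
              \<omega> = wedge_list scale (map w [1..<Suc r]) \<otimes>\<^bsub>ext_algebra scale\<^esub> \<alpha>))"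
proof -
  interpret Modules.module scale by fact
  interpret wedge_setting scale n e w r
    by unfold_locales fact
  have wedge: "wedge_list scale (map w [1..<Suc r]) = ext_class scale top_word"
    by (simp only: wedge_list_eq top_word_def)
  obtain y where y: "y \<in> hom_part k" and \<omega>: "\<omega> = ext_class scale y"
    using assms(7) unfolding ext_power_eq by blast
  have ann: "wd [w i] * y \<in> E" if "i \<in> {1..r}" for i
    using assms(8) that by (auto simp: \<omega> ext_vec_def ext_class_mult ext_class_zero ext_class_eq_iff)
  have "ext_class scale top_word = ext_class scale (\<Sum>S\<in>subsets r. sc (c S) * basis_word S)"
    using assms(5) finite_subsets[of r]
    by (simp only: has_coeffs_def wedge wedge_list_eq ext_scale_class ext_class_finsum basis_word_def top_word_def)
  then have expansion: "top_word - (\<Sum>S\<in>subsets r. sc (c S) * basis_word S) \<in> E"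
    by (simp only: ext_class_eq_iff)
  \<comment> \<open>Applying a coordinate to the given expansion shows that c is forced on the sets
    of size r, by duality with the basis words.\<close>
  have coord: "coord S top_word = c S" if S: "S \<in> subsets r" for S
  proof -
    have "coord S top_word = (\<Sum>T\<in>subsets r. c T * coord S (basis_word T))"
      using coord_E[OF expansion, of S] by simp
    also have "\<dots> = (\<Sum>T\<in>subsets r. if T = S then c S else 0)"
      using S by (intro sum.cong) (auto simp: coord_basis_word)
    finally show ?thesis
      using S by (simp add: finite_subsets)
  qed
  have I: "I = coord_ideal"
    unfolding assms(6) coord_ideal_def using coord by (intro arg_cong[of _ _ "genideal _"] image_cong) auto
  have divides: "\<exists>\<alpha> \<in> ext_power scale (k - int r). ext_class scale x =
      wedge_list scale (map w [1..<Suc r]) \<otimes>\<^bsub>ext_algebra scale\<^esub> \<alpha>"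
    if "\<exists>\<alpha>\<in>hom_part (k - int r). x - top_word * \<alpha> \<in> E" for x
    using that unfolding wedge ext_power_eq by (auto simp: ext_class_mult ext_class_eq_iff)
  have "ideal I ring_of_type_algebra"
    unfolding assms(6) by (rule type_Idl_ideal)
  \<comment> \<open>The exponent for (a) is m = 1; the power is taken in the monoid of
    ideals.\<close>
  then have "I [^]\<^bsub>ideals_set (ring_of_type_algebra :: 'a ring)\<^esub> (1::nat) = I"
    using comm_monoid.axioms(1)[OF cring.ideals_set_is_comm_monoid[OF cring_from_type_algebra]]
    by (intro monoid.nat_pow_eone) (auto simp: ideals_set_def)
  moreover have a: "\<exists>\<alpha> \<in> ext_power scale (k - int r). ext_scale scale g \<omega> =
      wedge_list scale (map w [1..<Suc r]) \<otimes>\<^bsub>ext_algebra scale\<^esub> \<alpha>" if "g \<in> I" for g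
    unfolding \<omega> ext_scale_class using annihilated_multiple[OF _ y ann] that I by (intro divides) blast
  moreover have "\<exists>\<alpha> \<in> ext_power scale (k - int r).
      \<omega> = wedge_list scale (map w [1..<Suc r]) \<otimes>\<^bsub>ext_algebra scale\<^esub> \<alpha>"
    if depth: "depth I > 0" "ereal (real_of_int k) < ereal_of_enat (depth I) + ereal (real r) - 1"
  proof (cases "I = UNIV")
    \<comment> \<open>The unit ideal has infinite depth by convention, not through sequences; here
      (a) with g = 1 gives the factorization in every degree.\<close>
    case True
    with a[of 1] show ?thesis by (simp add: \<omega> ext_scale_class sc_1)
  next
    case False
    obtain xs where "regular_sequence xs" "set xs \<subseteq> I" "xs \<noteq> []" "k < int (length xs) + int r - 1"
      using depth_witness[OF False depth] .
    then show ?thesis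
      unfolding \<omega> using I y ann
      by (intro divides annihilated_divisible regular_sequence_imp_regular_mod) auto
  qed
  ultimately show ?thesis
    by (metis (no_types, lifting))
qed

end
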